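(* Let $p\ge 5$ be a prime, $q=p^l$, $n\ge 2$ and $k\ge1$ integers, and $d=\gcd(k,q-1)$. Suppose $q>d^2$, $p\nmid k$, and $\gcd\big((q-1)/d,\,p-1\big)\ge 2$ (equivalently, the cyclic group $\mathbb F_p^\times\cap\{x^d\mid x\in\mathbb F_q\}$ has at least 2 elements). Then for $n>\max\left\{\frac{p^2-3p+9}{2},\frac{4\ln(k-1)}{\ln q}\right\}$ every matrix in $M_n(\mathbb F_q)$ is of the form $A^k+B^k$ with $A,B\in M_n(\mathbb F_q)$.
   Context: Convention: $\ln(0)=-\infty$ (relevant when $k=1$). *)

theory Defs
  imports
    "Jordan_Normal_Form.Matrix"
    "HOL-Computational_Algebra.Primes"
    "HOL-Library.Cardinality"
    "HOL-Library.Extended_Real"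
begin

text \<open>
  The library has \<open>ln 0 = 0\<close> on the reals; here the convention is \<open>ln 0 = -\<infinity>\<close>.
  It is only applied to arguments \<open>\<ge> 0\<close>.
\<close>

definition ln_ext :: "real \<Rightarrow> ereal" where
  "ln_ext x = (if x = 0 then -\<infinity> else ereal (ln x))"

end

theory Submission
  imports
    Defs
    "Jordan_Normal_Form.Determinant"
    "Jordan_Normal_Form.Column_Operations"
    "HOL-Analysis.Convex"
    "HOL-Algebra.Algebraic_Closure_Type"
    "HOL-Library.Indicator_Function"
    "HOL-Number_Theory.Cong"
begin

hide_const (open) Divisibility.prime Coset.order up_ring.monom up_ring.coeff Polynomials.degree

text \<open>
  A nonscalar matrix \<open>M\<close> is similar to a matrix with any prescribed diagonal of the same trace. If the
  diagonal entries are \<open>a\<^sub>i ^ k + b\<^sub>i ^ k\<close> with nonzero \<open>a\<^sub>i\<close>, \<open>b\<^sub>i\<close>, split the matrix into an upper and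
  a lower triangular one with diagonals \<open>a\<^sub>i ^ k\<close> and \<open>b\<^sub>i ^ k\<close>; since \<open>p\<close> does not divide \<open>k\<close>, each
  of them is a \<open>k\<close>-th power. So the trace has to be a sum of exactly \<open>2n\<close> nonzero \<open>k\<close>-th powers. With
  \<open>D\<close> the set of all \<open>k\<close>-th powers, \<open>|D|\<^sup>2 > q\<close> gives \<open>4D - 4D = F\<close>. For a prime divisor \<open>r\<close> of both
  \<open>(q - 1) / d\<close> and \<open>p - 1\<close>, some \<open>k\<close>-th power \<open>z \<noteq> 1\<close> has \<open>z\<^sup>r = 1\<close>, so \<open>-1\<close> is a sum of \<open>r - 1\<close>
  powers and \<open>0\<close> is a sum of \<open>r\<close> powers; as \<open>0\<close> is also a sum of \<open>p\<close> ones, the number of summands can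
  be padded to \<open>2n\<close>.

  For a scalar matrix \<open>\<lambda> I\<close>, embed the field \<open>K\<close> with \<open>q\<^sup>n\<close> elements into the \<open>n \<times> n\<close> matrices and
  solve \<open>x\<^sup>k + y\<^sup>k = \<lambda>\<close> in \<open>K\<close>. That this is possible for \<open>q\<^sup>n > (k - 1)\<^sup>4\<close> is the classical Jacobi
  sum estimate; here it is derived without characters, from the exact second moment of the number of
  solutions of the twisted equations \<open>x\<^sup>k / c + y\<^sup>k = \<lambda>\<close>.
\<close>

section \<open>Roots of triangular matrices\<close>

lemma index_mult_upper_triangular:
  fixes A B :: "'a::semiring_0 mat"
  assumes A: "A \<in> carrier_mat n n" "upper_triangular A"
    and B: "B \<in> carrier_mat n n" "upper_triangular B"
    and ij: "i < n" "j < n"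
  shows "(A * B) $$ (i, j) = (\<Sum>l\<in>{i..j}. A $$ (i, l) * B $$ (l, j))"
proof -
  have "(A * B) $$ (i, j) = (\<Sum>l\<in>{0..<n}. A $$ (i, l) * B $$ (l, j))"
    using A B ij by (simp add: scalar_prod_def)
  also have "\<dots> = (\<Sum>l\<in>{i..j}. A $$ (i, l) * B $$ (l, j))"
  proof (rule sum.mono_neutral_right)
    show "\<forall>l\<in>{0..<n} - {i..j}. A $$ (i, l) * B $$ (l, j) = 0"
    proof
      fix l assume "l \<in> {0..<n} - {i..j}"
      then have "l < i \<or> j < l" "l < n" by auto
      then show "A $$ (i, l) * B $$ (l, j) = 0"
        using A B ij by (auto dest: upper_triangularD)
    qed
  qed (use ij in auto)
  finally show ?thesis .
qed

lemma upper_triangular_mult: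
  fixes A B :: "'a::semiring_0 mat"
  assumes A: "A \<in> carrier_mat n n" "upper_triangular A"
    and B: "B \<in> carrier_mat n n" "upper_triangular B"
  shows "upper_triangular (A * B)"
proof (rule upper_triangularI)
  fix i j assume "j < i" "i < dim_row (A * B)"
  then show "(A * B) $$ (i, j) = 0"
    using A(1) index_mult_upper_triangular[OF A B, of i j] by (simp del: index_mult_mat(1))
qed

lemma upper_triangular_four_block_decomp:
  fixes U :: "'a::semiring_1 mat"
  assumes U: "U \<in> carrier_mat (Suc n) (Suc n)" "upper_triangular U"
  obtains a r U' where "r \<in> carrier_mat 1 n" "U' \<in> carrier_mat n n" "upper_triangular U'"
    "U = four_block_mat (a \<cdot>\<^sub>m 1\<^sub>m 1) r (0\<^sub>m n 1) U'"
proof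
  let ?r = "mat 1 n (\<lambda>(i, j). U $$ (0, Suc j))"
  let ?U' = "mat n n (\<lambda>(i, j). U $$ (Suc i, Suc j))"
  show "upper_triangular ?U'"
    using U by (auto intro!: upper_triangularI upper_triangularD[OF U(2)])
  show "U = four_block_mat (U $$ (0, 0) \<cdot>\<^sub>m 1\<^sub>m 1) ?r (0\<^sub>m n 1) ?U'"
    using U by (intro eq_matI) (auto intro: upper_triangularD[OF U(2)])
qed auto

text \<open>
  The upper right block of the \<open>k\<close>-th power of \<open>[[b I, s], [0, T]]\<close> is
  \<open>s * (b ^ (k - 1) + b ^ (k - 2) T + \<dots> + T ^ (k - 1))\<close>.
\<close>

fun hom_sum_mat :: "'a::comm_ring_1 \<Rightarrow> 'a mat \<Rightarrow> nat \<Rightarrow> 'a mat" where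
  "hom_sum_mat b T 0 = 0\<^sub>m (dim_row T) (dim_row T)"
| "hom_sum_mat b T (Suc k) = b ^ k \<cdot>\<^sub>m 1\<^sub>m (dim_row T) + hom_sum_mat b T k * T"

lemma hom_sum_mat_carrier [simp]:
  "T \<in> carrier_mat n n \<Longrightarrow> hom_sum_mat b T k \<in> carrier_mat n n"
  by (induction k) auto

lemma mult_hom_sum_mat_Suc:
  fixes T :: "'a::comm_ring_1 mat"
  assumes T: "T \<in> carrier_mat n n" and s: "s \<in> carrier_mat m n"
  shows "s * hom_sum_mat b T (Suc k) = (b ^ k \<cdot>\<^sub>m 1\<^sub>m m) * s + s * hom_sum_mat b T k * T"
proof -
  have "hom_sum_mat b T k * T \<in> carrier_mat n n" using T by (intro mult_carrier_mat) auto
  then have "s * hom_sum_mat b T (Suc k) = s * (b ^ k \<cdot>\<^sub>m 1\<^sub>m n) + s * (hom_sum_mat b T k * T)"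
    using T s by (simp add: mult_add_distrib_mat[OF s, of _ n])
  also have "s * (b ^ k \<cdot>\<^sub>m 1\<^sub>m n) = b ^ k \<cdot>\<^sub>m s"
    using s by (simp add: mult_smult_distrib[OF s, of _ n])
  also have "\<dots> = (b ^ k \<cdot>\<^sub>m 1\<^sub>m m) * s"
    using s by (simp add: mult_smult_assoc_mat[of _ m m _ n])
  also have "s * (hom_sum_mat b T k * T) = s * hom_sum_mat b T k * T"
    using s T by (simp add: assoc_mult_mat[of _ m n _ n _ n])
  finally show ?thesis .
qed

lemma pow_four_block_scalar_upper:
  fixes T :: "'a::comm_ring_1 mat"
  assumes T: "T \<in> carrier_mat n n" and s: "s \<in> carrier_mat m n"
  shows "four_block_mat (b \<cdot>\<^sub>m 1\<^sub>m m) s (0\<^sub>m n m) T ^\<^sub>m k =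
    four_block_mat (b ^ k \<cdot>\<^sub>m 1\<^sub>m m) (s * hom_sum_mat b T k) (0\<^sub>m n m) (T ^\<^sub>m k)"
proof (induction k)
  case 0
  have "1 \<cdot>\<^sub>m 1\<^sub>m m = (1\<^sub>m m :: 'a mat)" by (intro eq_matI) auto
  then show ?case using T s by simp
next
  case (Suc k)
  let ?S = "hom_sum_mat b T k"
  have S: "?S \<in> carrier_mat n n" and Tk: "T ^\<^sub>m k \<in> carrier_mat n n" using T by auto
  have sS: "s * ?S \<in> carrier_mat m n" using s S by auto
  have "b \<cdot>\<^sub>m (b ^ k \<cdot>\<^sub>m 1\<^sub>m m) = b ^ Suc k \<cdot>\<^sub>m (1\<^sub>m m :: 'a mat)" by (intro eq_matI) auto
  then have "(b ^ k \<cdot>\<^sub>m 1\<^sub>m m) * (b \<cdot>\<^sub>m 1\<^sub>m m) + s * ?S * 0\<^sub>m n m = b ^ Suc k \<cdot>\<^sub>m (1\<^sub>m m :: 'a mat)"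
    using right_mult_zero_mat[OF sS, of m] by (simp add: mult_smult_distrib[of _ m m _ m])
  moreover have "0\<^sub>m n m * (b \<cdot>\<^sub>m 1\<^sub>m m) + T ^\<^sub>m k * 0\<^sub>m n m = (0\<^sub>m n m :: 'a mat)"
    using right_mult_zero_mat[OF Tk, of m] by simp
  moreover have "0\<^sub>m n m * s + T ^\<^sub>m k * T = T ^\<^sub>m Suc k"
    using s T left_add_zero_mat[OF mult_carrier_mat[OF Tk T]] by simp
  ultimately show ?case
    unfolding pow_mat.simps(2) Suc.IH mult_hom_sum_mat_Suc[OF T s]
    using T s sS Tk by (subst mult_four_block_mat[of _ m m _ n _ n _ _ m _ n]) auto
qed

lemma upper_triangular_hom_sum_mat:
  fixes T :: "'a::comm_ring_1 mat"
  assumes T: "T \<in> carrier_mat n n" "upper_triangular T"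
  shows "upper_triangular (hom_sum_mat b T k)"
proof (induction k)
  case 0
  then show ?case using T by (simp add: upper_triangular_def)
next
  case (Suc k)
  have "upper_triangular (hom_sum_mat b T k * T)"
    using upper_triangular_mult[OF _ Suc T] T by simp
  then show ?case
    using T carrier_matD[OF hom_sum_mat_carrier[OF T(1), of b k]]
    by (auto simp: upper_triangular_def simp del: index_mult_mat(1))
qed

lemma diag_hom_sum_mat:
  fixes T :: "'a::comm_ring_1 mat"
  assumes T: "T \<in> carrier_mat n n" "upper_triangular T" and i: "i < n"
  shows "hom_sum_mat b T k $$ (i, i) = (\<Sum>j<k. b ^ (k - Suc j) * T $$ (i, i) ^ j)"
proof (induction k)
  case 0
  then show ?case using T i by simp
next
  case (Suc k)
  have "(hom_sum_mat b T k * T) $$ (i, i) = hom_sum_mat b T k $$ (i, i) * T $$ (i, i)"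
    using index_mult_upper_triangular[OF _ upper_triangular_hom_sum_mat[OF T] T i i] T(1) by simp
  then have "hom_sum_mat b T (Suc k) $$ (i, i) = b ^ k + hom_sum_mat b T k $$ (i, i) * T $$ (i, i)"
    using T i carrier_matD[OF hom_sum_mat_carrier[OF T(1), of b k]] by (simp del: index_mult_mat(1))
  also have "\<dots> = (\<Sum>j<Suc k. b ^ (Suc k - Suc j) * T $$ (i, i) ^ j)"
    unfolding Suc sum.lessThan_Suc_shift by (simp add: sum_distrib_left sum_distrib_right mult_ac)
  finally show ?case .
qed

lemma sum_powers_nonzero:
  fixes b t :: "'a::field"
  assumes "b \<noteq> 0" "of_nat k \<noteq> (0 :: 'a)" and inj: "b ^ k = t ^ k \<Longrightarrow> b = t"
  shows "(\<Sum>j<k. b ^ (k - Suc j) * t ^ j) \<noteq> 0"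
proof (cases "b = t")
  case True
  have "(\<Sum>j<k. b ^ (k - Suc j) * b ^ j) = (\<Sum>j<k. b ^ (k - 1))"
    by (intro sum.cong) (auto simp flip: power_add)
  then show ?thesis using assms(1,2) True by simp
next
  case False
  then have "t ^ k - b ^ k \<noteq> 0" using inj by auto
  then show ?thesis unfolding power_diff_sumr2 by simp
qed

lemma left_inverse_hom_sum_mat:
  fixes T :: "'a::field mat"
  assumes T: "T \<in> carrier_mat n n" "upper_triangular T"
    and "b \<noteq> 0" "of_nat k \<noteq> (0 :: 'a)"
    and "\<And>i. i < n \<Longrightarrow> b ^ k = T $$ (i, i) ^ k \<Longrightarrow> b = T $$ (i, i)"
  obtains B where "B \<in> carrier_mat n n" "B * hom_sum_mat b T k = 1\<^sub>m n"
proof -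
  let ?S = "hom_sum_mat b T k"
  have S: "?S \<in> carrier_mat n n" using T by simp
  have "?S $$ (i, i) \<noteq> 0" if "i < n" for i
    unfolding diag_hom_sum_mat[OF T that] using assms that by (intro sum_powers_nonzero) auto
  then have "det ?S \<noteq> 0"
    using S upper_triangular_imp_det_eq_0_iff[OF S upper_triangular_hom_sum_mat[OF T]]
    by (auto simp: diag_mat_def)
  from det_non_zero_imp_unit[OF S this, where b = "()"] show ?thesis
    using that by (auto simp: Units_def ring_mat_def)
qed

text \<open>
  A common choice \<open>\<rho>\<close> of roots for equal diagonal entries keeps the linear equation for the first
  row solvable.
\<close>

lemma upper_triangular_root_with_diag:
  fixes U :: "'a::field mat" and \<rho> :: "'a \<Rightarrow> 'a"
  assumes "U \<in> carrier_mat n n" "upper_triangular U" and k: "of_nat k \<noteq> (0 :: 'a)"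
    and "\<And>i. i < n \<Longrightarrow> U $$ (i, i) \<noteq> 0 \<and> \<rho> (U $$ (i, i)) ^ k = U $$ (i, i)"
  shows "\<exists>T\<in>carrier_mat n n. upper_triangular T \<and>
    (\<forall>i<n. T $$ (i, i) = \<rho> (U $$ (i, i))) \<and> T ^\<^sub>m k = U"
  using assms(1,2,4)
proof (induction n arbitrary: U)
  case 0
  then show ?case by (intro bexI[of _ U]) (auto simp: upper_triangular_def)
next
  case (Suc n)
  obtain a r U' where r: "r \<in> carrier_mat 1 n" and U': "U' \<in> carrier_mat n n" "upper_triangular U'"
    and U: "U = four_block_mat (a \<cdot>\<^sub>m 1\<^sub>m 1) r (0\<^sub>m n 1) U'"
    using upper_triangular_four_block_decomp[OF Suc.prems(1,2)] .
  have root_U': "U' $$ (i, i) \<noteq> 0 \<and> \<rho> (U' $$ (i, i)) ^ k = U' $$ (i, i)" if "i < n" for i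
    using Suc.prems(3)[of "Suc i"] that U' by (simp add: U)
  then obtain T where T: "T \<in> carrier_mat n n" "upper_triangular T" "T ^\<^sub>m k = U'"
    and diag_T: "\<And>i. i < n \<Longrightarrow> T $$ (i, i) = \<rho> (U' $$ (i, i))"
    using Suc.IH[OF U'] by blast
  define b where "b = \<rho> a"
  have a: "a \<noteq> 0" "b ^ k = a" using Suc.prems(3)[of 0] U' by (auto simp: U b_def)
  have b: "b \<noteq> 0" using a k by (cases k) auto
  have "b = T $$ (i, i)" if "i < n" "b ^ k = T $$ (i, i) ^ k" for i
    using that a(2) root_U'[OF that(1)] by (simp add: diag_T b_def)
  then obtain B where B: "B \<in> carrier_mat n n" "B * hom_sum_mat b T k = 1\<^sub>m n"
    using left_inverse_hom_sum_mat[OF T(1,2) b k] by blast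
  define R where "R = four_block_mat (b \<cdot>\<^sub>m 1\<^sub>m 1) (r * B) (0\<^sub>m n 1) T"
  have "r * B * hom_sum_mat b T k = r"
    using r B T by (simp add: assoc_mult_mat[of _ 1 n _ n _ n])
  moreover have "r * B \<in> carrier_mat 1 n" using r B by simp
  ultimately have "R ^\<^sub>m k = U"
    using pow_four_block_scalar_upper[OF T(1)] a(2) T(3) by (simp add: R_def U)
  moreover have "R \<in> carrier_mat (Suc n) (Suc n)"
    using four_block_carrier_mat[of "b \<cdot>\<^sub>m 1\<^sub>m 1" 1 1 T n n] T by (simp add: R_def)
  moreover have "upper_triangular R"
    unfolding R_def using T by (intro upper_triangular_four_block[of _ 1 _ n]) auto
  moreover have "R $$ (i, i) = \<rho> (U $$ (i, i))" if "i < Suc n" for i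
    using that T U' diag_T[of "i - 1"] by (cases i) (auto simp: R_def U b_def)
  ultimately show ?case by blast
qed

lemma upper_triangular_root:
  fixes U :: "'a::field mat"
  assumes "U \<in> carrier_mat n n" "upper_triangular U" "of_nat k \<noteq> (0 :: 'a)"
    and diag: "\<And>i. i < n \<Longrightarrow> \<exists>x. x \<noteq> 0 \<and> U $$ (i, i) = x ^ k"
  shows "\<exists>T\<in>carrier_mat n n. T ^\<^sub>m k = U"
proof -
  define \<rho> where "\<rho> a = (SOME x. x ^ k = a)" for a :: 'a
  have "U $$ (i, i) \<noteq> 0 \<and> \<rho> (U $$ (i, i)) ^ k = U $$ (i, i)" if "i < n" for i
    using diag[OF that] someI_ex[of "\<lambda>x. x ^ k = U $$ (i, i)"] by (metis \<rho>_def power_not_zero)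
  then show ?thesis using upper_triangular_root_with_diag[OF assms(1-3)] by blast
qed

section \<open>Matrices with prescribed diagonal\<close>

definition mat_trace :: "'a::comm_monoid_add mat \<Rightarrow> 'a" where
  "mat_trace A = (\<Sum>i<dim_row A. A $$ (i, i))"

lemma mat_trace_mult_commute:
  fixes A B :: "'a::comm_semiring_0 mat"
  assumes A: "A \<in> carrier_mat n m" and B: "B \<in> carrier_mat m n"
  shows "mat_trace (A * B) = mat_trace (B * A)"
proof -
  have "mat_trace (A * B) = (\<Sum>i<n. \<Sum>j<m. A $$ (i, j) * B $$ (j, i))"
    using A B by (simp add: mat_trace_def scalar_prod_def atLeast0LessThan)
  also have "\<dots> = (\<Sum>j<m. \<Sum>i<n. B $$ (j, i) * A $$ (i, j))"
    by (subst sum.swap) (simp add: mult.commute)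
  also have "\<dots> = mat_trace (B * A)"
    using A B by (simp add: mat_trace_def scalar_prod_def atLeast0LessThan)
  finally show ?thesis .
qed

lemma similar_mat_trace:
  fixes A B :: "'a::comm_semiring_1 mat"
  assumes A: "A \<in> carrier_mat n n" and sim: "similar_mat A B"
  shows "mat_trace A = mat_trace B"
proof -
  obtain P Q where wit: "similar_mat_wit A B P Q" using sim unfolding similar_mat_def by blast
  note PQ = similar_mat_witD2[OF A wit]
  have "mat_trace A = mat_trace (Q * (P * B))"
    using mat_trace_mult_commute[of "P * B" n n Q] PQ by simp
  also have "Q * (P * B) = B" using PQ by (simp add: assoc_mult_mat[of Q n n P n B n, symmetric])
  finally show ?thesis .
qed

lemma similar_mat_carrier:
  assumes "A \<in> carrier_mat n n" "similar_mat A B"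
  shows "B \<in> carrier_mat n n"
  using assms unfolding similar_mat_def by (blast dest: similar_mat_witD2)

lemma similar_mat_four_block_lower_right:
  fixes A D E :: "'a::comm_ring_1 mat"
  assumes carrier: "A \<in> carrier_mat n n" "B \<in> carrier_mat n m" "C \<in> carrier_mat m n" "D \<in> carrier_mat m m"
    and sim: "similar_mat D E"
  obtains B' C' where "B' \<in> carrier_mat n m" "C' \<in> carrier_mat m n"
    "similar_mat (four_block_mat A B C D) (four_block_mat A B' C' E)"
proof -
  obtain P Q where wit: "similar_mat_wit D E P Q" using sim unfolding similar_mat_def by blast
  note PQ = similar_mat_witD2[OF carrier(4) wit]
  have "similar_mat_wit (four_block_mat A B C D) (four_block_mat A (B * P) (Q * C) E)
    (four_block_mat (1\<^sub>m n) (0\<^sub>m n m) (0\<^sub>m m n) P) (four_block_mat (1\<^sub>m n) (0\<^sub>m n m) (0\<^sub>m m n) Q)"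
  proof (rule similar_mat_wit_four_block[OF similar_mat_wit_refl[OF carrier(1)] wit])
    show "B = 1\<^sub>m n * (B * P) * Q"
      using carrier PQ left_mult_one_mat[of "B * P" n m] by (simp add: assoc_mult_mat[of B n m P m Q m])
    show "C = P * (Q * C) * 1\<^sub>m n"
      using carrier PQ right_mult_one_mat[of "P * (Q * C)" m n]
      by (simp add: assoc_mult_mat[of P m m Q m C n, symmetric])
  qed (use carrier PQ in auto)
  then have "similar_mat (four_block_mat A B C D) (four_block_mat A (B * P) (Q * C) E)"
    unfolding similar_mat_def by blast
  moreover have "B * P \<in> carrier_mat n m" "Q * C \<in> carrier_mat m n" using carrier PQ by auto
  ultimately show ?thesis using that by blast
qed

lemma similar_mat_move_off_diag_entry:
  fixes M :: "'a::comm_ring_1 mat"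
  assumes M: "M \<in> carrier_mat n n" and ij: "i < n" "j < n" "i \<noteq> j"
  obtains N where "similar_mat M N" "N $$ (1, 0) = M $$ (i, j)"
proof
  define M' where "M' = swap_cols_rows 0 j M"
  define i' where "i' = (if i = 0 then j else i)"
  have i': "0 < i'" "i' < n" using ij by (auto simp: i'_def)
  have M': "M' \<in> carrier_mat n n" using M by (simp add: M'_def)
  have "similar_mat M M'" "similar_mat M' (swap_cols_rows 1 i' M')"
    using M M' ij i' by (auto simp: M'_def intro!: similar_mat_sym[OF swap_cols_rows_similar])
  then show "similar_mat M (swap_cols_rows 1 i' M')" by (rule similar_mat_trans)
  show "swap_cols_rows 1 i' M' $$ (1, 0) = M $$ (i, j)"
    using M M' ij i' by (auto simp: M'_def i'_def)
qed

lemma similar_mat_off_diag_nonzero: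
  fixes M :: "'a::comm_ring_1 mat"
  assumes M: "M \<in> carrier_mat n n" and nonscalar: "\<And>c. M \<noteq> c \<cdot>\<^sub>m 1\<^sub>m n"
  obtains N i j where "similar_mat M N" "i < n" "j < n" "i \<noteq> j" "N $$ (i, j) \<noteq> 0"
proof (cases "\<exists>i<n. \<exists>j<n. i \<noteq> j \<and> M $$ (i, j) \<noteq> 0")
  case True
  then obtain i j where "i < n" "j < n" "i \<noteq> j" "M $$ (i, j) \<noteq> 0" by blast
  then show ?thesis by (rule that[OF similar_mat_refl[OF M]])
next
  case False
  have "\<exists>i<n. M $$ (i, i) \<noteq> M $$ (0, 0)"
  proof (rule ccontr)
    assume "\<not> ?thesis"
    then obtain c where diag: "\<And>i. i < n \<Longrightarrow> M $$ (i, i) = c" by metis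
    have "M $$ (i, j) = (c \<cdot>\<^sub>m 1\<^sub>m n) $$ (i, j)" if "i < n" "j < n" for i j
      using that False diag[OF that(1)] by (cases "i = j") auto
    then have "M = c \<cdot>\<^sub>m 1\<^sub>m n" using M by (intro eq_matI) auto
    then show False using nonscalar by blast
  qed
  then obtain i where i: "i < n" "M $$ (i, i) \<noteq> M $$ (0, 0)" "i \<noteq> 0" by auto
  show ?thesis
  proof
    show "similar_mat M (add_col_sub_row 1 0 i M)"
      using i M by (intro similar_mat_sym[OF add_col_sub_row_similar[OF M]]) auto
    have "M $$ (0, i) = 0" "M $$ (i, 0) = 0" using i False by auto
    then show "add_col_sub_row 1 0 i M $$ (0, i) \<noteq> 0" using i M by auto
  qed (use i in auto)
qed

lemma nonscalar_similar_mat_subdiag_nonzero: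
  fixes M :: "'a::comm_ring_1 mat"
  assumes M: "M \<in> carrier_mat n n" and nonscalar: "\<And>c. M \<noteq> c \<cdot>\<^sub>m 1\<^sub>m n"
  obtains N where "similar_mat M N" "N $$ (1, 0) \<noteq> 0" "n \<ge> 2"
proof -
  obtain L i j where L: "similar_mat M L" and ij: "i < n" "j < n" "i \<noteq> j" and "L $$ (i, j) \<noteq> 0"
    using similar_mat_off_diag_nonzero[OF M nonscalar] by metis
  moreover obtain N where "similar_mat L N" "N $$ (1, 0) = L $$ (i, j)"
    using similar_mat_move_off_diag_entry[OF similar_mat_carrier[OF M L] ij] .
  ultimately show ?thesis using that similar_mat_trans by fastforce
qed

text \<open>
  The entry \<open>(2, 1)\<close> becomes the entry \<open>(1, 0)\<close> of the block that remains when the corner is split off,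
  so that the induction can continue with this block.
\<close>

lemma similar_mat_prescribed_corner:
  fixes M :: "'a::field mat"
  assumes M: "M \<in> carrier_mat n n" and n: "n \<ge> 2" and subdiag: "M $$ (1, 0) \<noteq> 0"
  obtains N where "similar_mat M N" "N $$ (0, 0) = a" "n \<ge> 3 \<Longrightarrow> N $$ (2, 1) \<noteq> 0"
proof -
  define L where "L = (if n \<ge> 3 \<and> M $$ (1, 2) = 0 then add_col_sub_row 1 0 2 M else M)"
  define K where "K = add_col_sub_row ((L $$ (0, 0) - a) / M $$ (1, 0)) 0 1 L"
  define N where "N = (if n \<ge> 3 then swap_cols_rows 1 2 K else K)"
  have L: "L \<in> carrier_mat n n" using M by (simp add: L_def)
  then have K: "K \<in> carrier_mat n n" by (simp add: K_def)
  have "L $$ (1, 0) = M $$ (1, 0)" using M n by (simp add: L_def)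
  then have "K $$ (0, 0) = a" using L n subdiag by (simp add: K_def)
  then have "N $$ (0, 0) = a" using K n by (simp add: N_def)
  moreover have "N $$ (2, 1) \<noteq> 0" if "n \<ge> 3"
  proof -
    have "L $$ (1, 2) \<noteq> 0" using that M subdiag by (simp add: L_def)
    then have "K $$ (1, 2) \<noteq> 0" using that L by (simp add: K_def)
    then show ?thesis using that K by (simp add: N_def)
  qed
  moreover have "similar_mat M L"
    using M n by (auto simp: L_def intro: similar_mat_refl similar_mat_sym[OF add_col_sub_row_similar])
  moreover have "similar_mat L K"
    using L n by (auto simp: K_def intro: similar_mat_sym[OF add_col_sub_row_similar])
  moreover have "similar_mat K N"
    using K n by (auto simp: N_def intro: similar_mat_refl similar_mat_sym[OF swap_cols_rows_similar])
  ultimately show ?thesis using that similar_mat_trans by blast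
qed

lemma similar_mat_prescribed_diag_of_subdiag:
  fixes M :: "'a::field mat"
  assumes "M \<in> carrier_mat n n" "n \<ge> 1" "n \<ge> 2 \<Longrightarrow> M $$ (1, 0) \<noteq> 0" "mat_trace M = (\<Sum>i<n. f i)"
  shows "\<exists>N. similar_mat M N \<and> (\<forall>i<n. N $$ (i, i) = f i)"
  using assms
proof (induction n arbitrary: M f)
  case 0
  then show ?case by simp
next
  case (Suc n)
  note M = Suc.prems(1)
  show ?case
  proof (cases "n = 0")
    case True
    then have "M $$ (0, 0) = f 0" using M Suc.prems(4) by (simp add: mat_trace_def)
    then show ?thesis using True similar_mat_refl[OF M] by auto
  next
    case False
    then have "M $$ (1, 0) \<noteq> 0" using Suc.prems(3) by simp
    then obtain L where L: "similar_mat M L" "L $$ (0, 0) = f 0" "Suc n \<ge> 3 \<Longrightarrow> L $$ (2, 1) \<noteq> 0"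
      using similar_mat_prescribed_corner[OF M, of "f 0"] False by auto
    have L': "L \<in> carrier_mat (Suc n) (Suc n)" by (rule similar_mat_carrier[OF M L(1)])
    obtain A B C D where split: "split_block L 1 1 = (A, B, C, D)" by (metis prod_cases4)
    have blocks: "A \<in> carrier_mat 1 1" "B \<in> carrier_mat 1 n" "C \<in> carrier_mat n 1" "D \<in> carrier_mat n n"
      and L_eq: "L = four_block_mat A B C D" using split_block[OF split, of n n] L' by auto
    have D: "D $$ (i, j) = L $$ (Suc i, Suc j)" if "i < n" "j < n" for i j
      using blocks that by (simp add: L_eq)
    have "mat_trace L = (\<Sum>i<Suc n. f i)" using similar_mat_trace[OF M L(1)] Suc.prems(4) by simp
    then have "mat_trace D = (\<Sum>i<n. f (Suc i))"
      using L' blocks(4) L(2) by (simp add: mat_trace_def D sum.lessThan_Suc_shift del: sum.lessThan_Suc)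
    then obtain E where E: "similar_mat D E" "\<And>i. i < n \<Longrightarrow> E $$ (i, i) = f (Suc i)"
      using Suc.IH[OF blocks(4), of "\<lambda>i. f (Suc i)"] False L(3) by (force simp: D numeral_2_eq_2)
    obtain B' C' where "similar_mat L (four_block_mat A B' C' E)"
      using similar_mat_four_block_lower_right[OF blocks E(1)] L_eq by metis
    then have "similar_mat M (four_block_mat A B' C' E)" by (rule similar_mat_trans[OF L(1)])
    moreover have "A $$ (0, 0) = f 0" using blocks L(2) by (simp add: L_eq)
    then have "four_block_mat A B' C' E $$ (i, i) = f i" if "i < Suc n" for i
      using that blocks(1) similar_mat_carrier[OF blocks(4) E(1)] E(2) by (cases i) auto
    ultimately show ?thesis by blast
  qed
qed

lemma nonscalar_similar_mat_prescribed_diag: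
  fixes M :: "'a::field mat"
  assumes M: "M \<in> carrier_mat n n" and nonscalar: "\<And>c. M \<noteq> c \<cdot>\<^sub>m 1\<^sub>m n"
    and trace: "mat_trace M = (\<Sum>i<n. f i)"
  obtains N where "similar_mat M N" "\<And>i. i < n \<Longrightarrow> N $$ (i, i) = f i"
proof -
  obtain L where L: "similar_mat M L" "L $$ (1, 0) \<noteq> 0" "n \<ge> 2"
    using nonscalar_similar_mat_subdiag_nonzero[OF M nonscalar] by metis
  have "\<exists>N. similar_mat L N \<and> (\<forall>i<n. N $$ (i, i) = f i)"
    using similar_mat_prescribed_diag_of_subdiag[OF similar_mat_carrier[OF M L(1)]] L
      similar_mat_trace[OF M L(1)] trace by simp
  then show ?thesis using similar_mat_trans[OF L(1)] that by metis
qed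

section \<open>Matrices as sums of two powers\<close>

definition is_sum_of_two_powers :: "nat \<Rightarrow> 'a::semiring_1 mat \<Rightarrow> bool" where
  "is_sum_of_two_powers k M \<longleftrightarrow>
    (\<exists>A\<in>carrier_mat (dim_row M) (dim_row M). \<exists>B\<in>carrier_mat (dim_row M) (dim_row M).
      M = A ^\<^sub>m k + B ^\<^sub>m k)"

lemma is_sum_of_two_powersI:
  assumes "A \<in> carrier_mat n n" "B \<in> carrier_mat n n" "M = A ^\<^sub>m k + B ^\<^sub>m k"
  shows "is_sum_of_two_powers k M"
proof -
  have "dim_row M = n" using assms by simp
  then show ?thesis using assms unfolding is_sum_of_two_powers_def by blast
qed

lemma pow_mat_Suc_left:
  fixes A :: "'a::semiring_1 mat"
  assumes A: "A \<in> carrier_mat n n"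
  shows "A ^\<^sub>m Suc k = A * A ^\<^sub>m k"
proof (induction k)
  case 0
  then show ?case using A by simp
next
  case (Suc k)
  have "A ^\<^sub>m Suc (Suc k) = A * A ^\<^sub>m k * A" by (simp only: pow_mat.simps(2)[of A "Suc k"] Suc)
  also have "\<dots> = A * A ^\<^sub>m Suc k" using A by (simp add: assoc_mult_mat[of _ n n _ n _ n])
  finally show ?case .
qed

lemma transpose_pow_mat:
  fixes A :: "'a::comm_semiring_1 mat"
  assumes A: "A \<in> carrier_mat n n"
  shows "transpose_mat (A ^\<^sub>m k) = transpose_mat A ^\<^sub>m k"
proof (induction k)
  case 0
  then show ?case using A by simp
next
  case (Suc k)
  have "transpose_mat (A ^\<^sub>m Suc k) = transpose_mat A * transpose_mat A ^\<^sub>m k"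
    using A Suc by (simp add: transpose_mult[of _ n n _ n])
  then show ?case using pow_mat_Suc_left[of "transpose_mat A" n k] A by simp
qed

lemma is_sum_of_two_powers_similar:
  fixes M N :: "'a::comm_ring_1 mat"
  assumes M: "M \<in> carrier_mat n n" and sim: "similar_mat M N" and N: "is_sum_of_two_powers k N"
  shows "is_sum_of_two_powers k M"
proof -
  have "dim_row N = n" using similar_mat_carrier[OF M sim] by simp
  then obtain A B where AB: "A \<in> carrier_mat n n" "B \<in> carrier_mat n n" and N_eq: "N = A ^\<^sub>m k + B ^\<^sub>m k"
    using N unfolding is_sum_of_two_powers_def by blast
  obtain P Q where wit: "similar_mat_wit M N P Q" using sim unfolding similar_mat_def by blast
  note PQ = similar_mat_witD2[OF M wit]
  have conj: "P * C ^\<^sub>m k * Q = (P * C * Q) ^\<^sub>m k" if "C \<in> carrier_mat n n" for C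
  proof -
    have "similar_mat_wit (P * C * Q) C P Q"
      using PQ that by (intro similar_mat_witI[of _ _ n]) auto
    then show ?thesis using similar_mat_wit_pow_id by metis
  qed
  have "M = P * (A ^\<^sub>m k + B ^\<^sub>m k) * Q" using PQ(3) N_eq by simp
  also have "\<dots> = P * A ^\<^sub>m k * Q + P * B ^\<^sub>m k * Q"
    using PQ pow_carrier_mat[OF AB(1), of k] pow_carrier_mat[OF AB(2), of k]
    by (simp add: mult_add_distrib_mat[of _ n n _ n] add_mult_distrib_mat[of _ n n _ _ n])
  also have "\<dots> = (P * A * Q) ^\<^sub>m k + (P * B * Q) ^\<^sub>m k"
    using AB by (simp add: conj)
  finally show ?thesis using PQ AB by (intro is_sum_of_two_powersI[of "P * A * Q" n "P * B * Q"]) auto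
qed

lemma is_sum_of_two_powers_of_diag:
  fixes M :: "'a::field mat"
  assumes M: "M \<in> carrier_mat n n" and k: "of_nat k \<noteq> (0 :: 'a)"
    and nonzero: "\<And>i. i < n \<Longrightarrow> a i \<noteq> 0" "\<And>i. i < n \<Longrightarrow> b i \<noteq> 0"
    and diag: "\<And>i. i < n \<Longrightarrow> M $$ (i, i) = a i ^ k + b i ^ k"
  shows "is_sum_of_two_powers k M"
proof -
  define U where "U = mat n n (\<lambda>(i, j). if i = j then a i ^ k else if i < j then M $$ (i, j) else 0)"
  define L where "L = mat n n (\<lambda>(i, j). if i = j then b i ^ k else if i < j then M $$ (j, i) else 0)"
  have U: "U \<in> carrier_mat n n" "upper_triangular U" and L: "L \<in> carrier_mat n n" "upper_triangular L"
    by (auto simp: U_def L_def upper_triangular_def)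
  have "\<exists>x. x \<noteq> 0 \<and> U $$ (i, i) = x ^ k" "\<exists>x. x \<noteq> 0 \<and> L $$ (i, i) = x ^ k" if "i < n" for i
    using nonzero[OF that] that by (auto simp: U_def L_def)
  then obtain A B where A: "A \<in> carrier_mat n n" "A ^\<^sub>m k = U" and B: "B \<in> carrier_mat n n" "B ^\<^sub>m k = L"
    using upper_triangular_root[OF U k] upper_triangular_root[OF L k] by blast
  have "M = U + transpose_mat L"
    using M diag by (intro eq_matI) (auto simp: U_def L_def)
  also have "\<dots> = A ^\<^sub>m k + transpose_mat B ^\<^sub>m k"
    using A B transpose_pow_mat[OF B(1), of k] by simp
  finally show ?thesis using A B by (intro is_sum_of_two_powersI[of A n "transpose_mat B"]) auto
qed

lemma nonscalar_is_sum_of_two_powers: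
  fixes M :: "'a::field mat"
  assumes M: "M \<in> carrier_mat n n" and nonscalar: "\<And>c. M \<noteq> c \<cdot>\<^sub>m 1\<^sub>m n"
    and k: "of_nat k \<noteq> (0 :: 'a)"
    and nonzero: "\<And>i. i < n \<Longrightarrow> a i \<noteq> 0" "\<And>i. i < n \<Longrightarrow> b i \<noteq> 0"
    and trace: "mat_trace M = (\<Sum>i<n. a i ^ k + b i ^ k)"
  shows "is_sum_of_two_powers k M"
proof -
  obtain N where sim: "similar_mat M N" and diag: "\<And>i. i < n \<Longrightarrow> N $$ (i, i) = a i ^ k + b i ^ k"
    using nonscalar_similar_mat_prescribed_diag[OF M nonscalar trace] by metis
  have "is_sum_of_two_powers k N"
    using similar_mat_carrier[OF M sim] k nonzero diag by (rule is_sum_of_two_powers_of_diag)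
  then show ?thesis by (rule is_sum_of_two_powers_similar[OF M sim])
qed

section \<open>Rectangle sums of functions with vanishing marginals\<close>

definition centered_indicator :: "'a set \<Rightarrow> 'a set \<Rightarrow> 'a \<Rightarrow> real" where
  "centered_indicator S A x = indicator A x - real (card A) / real (card S)"

lemma sum_mult_centered_indicator:
  assumes "finite S" "A \<subseteq> S" "(\<Sum>x\<in>S. \<phi> x) = 0"
  shows "(\<Sum>x\<in>S. \<phi> x * centered_indicator S A x) = (\<Sum>x\<in>A. \<phi> x)"
proof -
  have "S \<inter> A = A" using assms(2) by auto
  then show ?thesis
    using assms by (simp add: centered_indicator_def right_diff_distrib sum_subtractf
      flip: sum_distrib_right sum_divide_distrib)
qed

lemma sum_centered_indicator_square:
  assumes S: "finite S" and A: "A \<subseteq> S"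
  shows "(\<Sum>x\<in>S. (centered_indicator S A x)\<^sup>2) = real (card A) * (1 - real (card A) / real (card S))"
proof (cases "S = {}")
  case True
  then show ?thesis using A by simp
next
  case False
  let ?\<alpha> = "real (card A) / real (card S)"
  have A_eq: "S \<inter> A = A" using A by auto
  have "(\<Sum>x\<in>S. (centered_indicator S A x)\<^sup>2) = (\<Sum>x\<in>S. indicator A x * (1 - 2 * ?\<alpha>) + ?\<alpha>\<^sup>2)"
    by (intro sum.cong refl) (auto simp: centered_indicator_def indicator_def power2_eq_square algebra_simps)
  also have "\<dots> = real (card A) * (1 - 2 * ?\<alpha>) + real (card S) * ?\<alpha>\<^sup>2"
    using S A_eq by (simp add: sum.distrib)
  also have "\<dots> = real (card A) * (1 - ?\<alpha>)"
    using S False by (simp add: field_simps power2_eq_square)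
  finally show ?thesis .
qed

text \<open>
  Cauchy-Schwarz against the indicator of the rectangle. Removing its means in both variables costs
  nothing, as the marginals of \<open>W\<close> vanish, and gains the two factors on the right.
\<close>

lemma rectangle_sum_square_le:
  fixes W :: "'a \<Rightarrow> 'b \<Rightarrow> real"
  assumes S: "finite S" "A \<subseteq> S" and T: "finite T" "B \<subseteq> T"
    and rows: "\<And>s. s \<in> S \<Longrightarrow> (\<Sum>t\<in>T. W s t) = 0" and columns: "\<And>t. t \<in> T \<Longrightarrow> (\<Sum>s\<in>S. W s t) = 0"
  shows "(\<Sum>s\<in>A. \<Sum>t\<in>B. W s t)\<^sup>2 \<le> (\<Sum>s\<in>S. \<Sum>t\<in>T. (W s t)\<^sup>2) *
    (real (card A) * (1 - real (card A) / real (card S)) *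
     (real (card B) * (1 - real (card B) / real (card T))))"
proof -
  let ?f = "centered_indicator S A" and ?g = "centered_indicator T B"
  have "(\<Sum>s\<in>S. \<Sum>t\<in>T. W s t * (?f s * ?g t)) = (\<Sum>s\<in>S. (\<Sum>t\<in>T. W s t * ?g t) * ?f s)"
    by (simp add: sum_distrib_left sum_distrib_right mult_ac)
  also have "\<dots> = (\<Sum>s\<in>S. (\<Sum>t\<in>B. W s t) * ?f s)"
    using rows T by (simp add: sum_mult_centered_indicator)
  also have "\<dots> = (\<Sum>s\<in>A. \<Sum>t\<in>B. W s t)"
  proof (rule sum_mult_centered_indicator[OF S])
    have "(\<Sum>t\<in>B. \<Sum>s\<in>S. W s t) = 0" using columns T by (simp add: subset_iff)
    then show "(\<Sum>s\<in>S. \<Sum>t\<in>B. W s t) = 0" by (subst sum.swap)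
  qed
  finally have rectangle: "(\<Sum>s\<in>S. \<Sum>t\<in>T. W s t * (?f s * ?g t)) = (\<Sum>s\<in>A. \<Sum>t\<in>B. W s t)" .
  have "(\<Sum>s\<in>S. \<Sum>t\<in>T. (?f s * ?g t)\<^sup>2) = (\<Sum>s\<in>S. (?f s)\<^sup>2) * (\<Sum>t\<in>T. (?g t)\<^sup>2)"
    by (simp add: power_mult_distrib sum_product)
  then have weights: "(\<Sum>s\<in>S. \<Sum>t\<in>T. (?f s * ?g t)\<^sup>2) =
      real (card A) * (1 - real (card A) / real (card S)) *
      (real (card B) * (1 - real (card B) / real (card T)))"
    by (simp only: sum_centered_indicator_square[OF S] sum_centered_indicator_square[OF T])
  have "(\<Sum>s\<in>S. \<Sum>t\<in>T. W s t * (?f s * ?g t))\<^sup>2 \<le>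
    (\<Sum>s\<in>S. \<Sum>t\<in>T. (W s t)\<^sup>2) * (\<Sum>s\<in>S. \<Sum>t\<in>T. (?f s * ?g t)\<^sup>2)"
    using Cauchy_Schwarz_ineq_sum[of "\<lambda>(s, t). W s t" "\<lambda>(s, t). ?f s * ?g t" "S \<times> T"]
    by (simp add: case_prod_unfold sum.cartesian_product')
  then show ?thesis by (simp only: rectangle weights)
qed

section \<open>Twisted convolutions on a finite field\<close>

locale finite_subfield =
  fixes K :: "'b::field set"
  assumes finite_K [simp]: "finite K"
    and zero_mem [simp]: "0 \<in> K" and one_mem [simp]: "1 \<in> K"
    and add_mem [simp]: "x \<in> K \<Longrightarrow> y \<in> K \<Longrightarrow> x + y \<in> K"
    and uminus_mem [simp]: "x \<in> K \<Longrightarrow> - x \<in> K"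
    and mult_mem [simp]: "x \<in> K \<Longrightarrow> y \<in> K \<Longrightarrow> x * y \<in> K"
    and inverse_mem [simp]: "x \<in> K \<Longrightarrow> inverse x \<in> K"
begin

lemma diff_mem [simp]: "x \<in> K \<Longrightarrow> y \<in> K \<Longrightarrow> x - y \<in> K"
  using add_mem[of x "- y"] by simp

lemma divide_mem [simp]: "x \<in> K \<Longrightarrow> y \<in> K \<Longrightarrow> x / y \<in> K"
  by (simp add: field_class.field_divide_inverse)

lemma power_mem [simp]: "x \<in> K \<Longrightarrow> x ^ n \<in> K"
  by (induction n) auto

lemma card_gt_1: "card K > 1"
  using card_mono[OF finite_K, of "{0, 1}"] by simp

lemma card_units: "card (K - {0}) = card K - 1"
  by (simp add: card_Diff_singleton)

lemma sum_translate: "a \<in> K \<Longrightarrow> (\<Sum>x\<in>K. \<phi> (x - a)) = (\<Sum>x\<in>K. \<phi> x)"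
  by (rule sum.reindex_bij_witness[of _ "\<lambda>x. x + a" "\<lambda>x. x - a"]) auto

lemma sum_reflect: "a \<in> K \<Longrightarrow> (\<Sum>x\<in>K. \<phi> (a - x)) = (\<Sum>x\<in>K. \<phi> x)"
  by (rule sum.reindex_bij_witness[of _ "\<lambda>x. a - x" "\<lambda>x. a - x"]) auto

lemma sum_scale: "c \<in> K - {0} \<Longrightarrow> (\<Sum>x\<in>K. \<phi> (c * x)) = (\<Sum>x\<in>K. \<phi> x)"
  by (rule sum.reindex_bij_witness[of _ "\<lambda>x. x / c" "\<lambda>x. c * x"]) auto

lemma sum_units_scale: "t \<in> K - {0} \<Longrightarrow> (\<Sum>c\<in>K - {0}. \<phi> (c * t)) = (\<Sum>c\<in>K - {0}. \<phi> c)"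
  by (rule sum.reindex_bij_witness[of _ "\<lambda>x. x / t" "\<lambda>x. x * t"]) auto

definition twisted_conv :: "('b \<Rightarrow> real) \<Rightarrow> 'b \<Rightarrow> 'b \<Rightarrow> real" where
  "twisted_conv g c y = (\<Sum>x\<in>K. g (c * x) * g (y - x))"

definition autocorr :: "('b \<Rightarrow> real) \<Rightarrow> 'b \<Rightarrow> real" where
  "autocorr g t = (\<Sum>x\<in>K. g x * g (x + t))"

lemma sum_twisted_conv:
  assumes "(\<Sum>x\<in>K. g x) = 0"
  shows "(\<Sum>y\<in>K. twisted_conv g c y) = 0"
proof -
  have "(\<Sum>y\<in>K. twisted_conv g c y) = (\<Sum>x\<in>K. g (c * x) * (\<Sum>y\<in>K. g (y - x)))"
    unfolding twisted_conv_def by (subst sum.swap) (simp add: sum_distrib_left)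
  also have "\<dots> = 0"
    using assms by (simp add: sum_translate)
  finally show ?thesis .
qed

lemma sum_twists_twisted_conv:
  assumes g0: "g 0 = 0" and sum_g: "(\<Sum>x\<in>K. g x) = 0"
  shows "(\<Sum>c\<in>K - {0}. twisted_conv g c y) = 0"
proof -
  have sum_units: "(\<Sum>c\<in>K - {0}. g c) = 0"
    using sum_g g0 by (simp add: sum.remove[of K 0])
  have "(\<Sum>c\<in>K - {0}. twisted_conv g c y) = (\<Sum>x\<in>K. (\<Sum>c\<in>K - {0}. g (c * x)) * g (y - x))"
    unfolding twisted_conv_def by (subst sum.swap) (simp add: sum_distrib_right)
  also have "\<dots> = 0"
  proof (rule sum.neutral, rule ballI)
    fix x assume "x \<in> K"
    then have "(\<Sum>c\<in>K - {0}. g (c * x)) = 0"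
      using g0 sum_units_scale[of x g] sum_units by (cases "x = 0") auto
    then show "(\<Sum>c\<in>K - {0}. g (c * x)) * g (y - x) = 0" by simp
  qed
  finally show ?thesis .
qed

lemma sum_autocorr:
  assumes "(\<Sum>x\<in>K. g x) = 0"
  shows "(\<Sum>t\<in>K. autocorr g t) = 0"
proof -
  have translate: "(\<Sum>t\<in>K. g (x + t)) = 0" if "x \<in> K" for x
    using sum_translate[of "- x" g] that assms by (simp add: add.commute)
  have "(\<Sum>t\<in>K. autocorr g t) = (\<Sum>x\<in>K. g x * (\<Sum>t\<in>K. g (x + t)))"
    unfolding autocorr_def by (subst sum.swap) (simp add: sum_distrib_left)
  then show ?thesis by (simp add: translate)
qed

lemma autocorr_scale:
  assumes c: "c \<in> K - {0}" and t: "t \<in> K"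
  shows "(\<Sum>x\<in>K. g (c * x) * g (c * (x - t))) = autocorr g (c * t)"
proof -
  have "(\<Sum>x\<in>K. g (c * x) * g (c * (x - t))) = (\<Sum>x\<in>K. g x * g (x - c * t))"
    using sum_scale[OF c, of "\<lambda>x. g x * g (x - c * t)"] by (simp add: right_diff_distrib)
  also have "\<dots> = autocorr g (c * t)"
    using sum_translate[of "c * t" "\<lambda>x. g (x + c * t) * g x"] t c
    by (simp add: autocorr_def mult.commute)
  finally show ?thesis .
qed

lemma sum_twisted_conv_square:
  assumes c: "c \<in> K - {0}"
  shows "(\<Sum>y\<in>K. (twisted_conv g c y)\<^sup>2) = (\<Sum>t\<in>K. autocorr g t * autocorr g (c * t))"
proof -
  have corr: "(\<Sum>y\<in>K. g (y - x) * g (y - (x - t))) = autocorr g t" if "x \<in> K" for x t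
    using sum_translate[OF that, of "\<lambda>z. g z * g (z + t)"] by (simp add: autocorr_def algebra_simps)
  have "(\<Sum>y\<in>K. (twisted_conv g c y)\<^sup>2) =
    (\<Sum>y\<in>K. \<Sum>x\<in>K. \<Sum>x'\<in>K. g (c * x) * g (c * x') * (g (y - x) * g (y - x')))"
    unfolding twisted_conv_def power2_eq_square by (simp add: sum_product mult_ac)
  also have "\<dots> = (\<Sum>y\<in>K. \<Sum>x\<in>K. \<Sum>t\<in>K. g (c * x) * g (c * (x - t)) * (g (y - x) * g (y - (x - t))))"
    by (intro sum.cong refl sum_reflect[symmetric])
  also have "\<dots> = (\<Sum>x\<in>K. \<Sum>t\<in>K. \<Sum>y\<in>K. g (c * x) * g (c * (x - t)) * (g (y - x) * g (y - (x - t))))"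
    by (subst sum.swap) (intro sum.cong refl sum.swap)
  also have "\<dots> = (\<Sum>x\<in>K. \<Sum>t\<in>K. g (c * x) * g (c * (x - t)) * autocorr g t)"
    by (intro sum.cong refl) (simp add: sum_distrib_left[symmetric] corr)
  also have "\<dots> = (\<Sum>t\<in>K. autocorr g t * (\<Sum>x\<in>K. g (c * x) * g (c * (x - t))))"
    by (subst sum.swap) (simp add: sum_distrib_left mult_ac)
  also have "\<dots> = (\<Sum>t\<in>K. autocorr g t * autocorr g (c * t))"
    by (intro sum.cong refl) (simp only: autocorr_scale[OF c])
  finally show ?thesis .
qed

lemma twisted_conv_second_moment:
  assumes sum_g: "(\<Sum>x\<in>K. g x) = 0"
  shows "(\<Sum>c\<in>K - {0}. \<Sum>y\<in>K. (twisted_conv g c y)\<^sup>2) = real (card K) * (\<Sum>x\<in>K. (g x)\<^sup>2)\<^sup>2"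
proof -
  define E where "E = (\<Sum>x\<in>K. (g x)\<^sup>2)"
  have zero: "autocorr g 0 = E" by (simp add: autocorr_def E_def power2_eq_square)
  have units: "(\<Sum>t\<in>K - {0}. autocorr g t) = - E"
    using sum_autocorr[OF sum_g] zero by (simp add: sum.remove[of K 0])
  have "(\<Sum>c\<in>K - {0}. \<Sum>y\<in>K. (twisted_conv g c y)\<^sup>2) =
      (\<Sum>c\<in>K - {0}. \<Sum>t\<in>K. autocorr g t * autocorr g (c * t))"
    by (intro sum.cong refl sum_twisted_conv_square)
  also have "\<dots> = (\<Sum>t\<in>K. autocorr g t * (\<Sum>c\<in>K - {0}. autocorr g (c * t)))"
    by (subst sum.swap) (simp add: sum_distrib_left)
  also have "\<dots> = E * (\<Sum>c\<in>K - {0}. E) + (\<Sum>t\<in>K - {0}. autocorr g t * (\<Sum>c\<in>K - {0}. autocorr g (c * t)))"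
    by (simp add: sum.remove[of K 0] zero)
  also have "(\<Sum>t\<in>K - {0}. autocorr g t * (\<Sum>c\<in>K - {0}. autocorr g (c * t))) = (\<Sum>t\<in>K - {0}. autocorr g t * (- E))"
    by (intro sum.cong refl) (simp only: sum_units_scale units)
  also have "\<dots> = E * E" by (simp only: sum_distrib_right[symmetric] units minus_mult_minus)
  also have "E * (\<Sum>c\<in>K - {0}. E) + E * E = real (card K) * E\<^sup>2"
    using card_gt_1 by (simp add: card_units of_nat_diff power2_eq_square algebra_simps)
  finally show ?thesis unfolding E_def .
qed

lemma power_card_minus_one:
  assumes "x \<in> K - {0}"
  shows "x ^ (card K - 1) = 1"
proof -
  have "(\<Prod>y\<in>K - {0}. y) = (\<Prod>y\<in>K - {0}. x * y)"
    using assms by (intro prod.reindex_bij_witness[of _ "\<lambda>y. x * y" "\<lambda>y. y / x"]) auto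
  also have "\<dots> = x ^ (card K - 1) * (\<Prod>y\<in>K - {0}. y)"
    by (simp add: prod.distrib card_units)
  finally show ?thesis by simp
qed

lemma power_card: "x \<in> K \<Longrightarrow> x ^ card K = x"
  using power_card_minus_one[of x] card_gt_1 power_minus_mult[of "card K" x]
  by (cases "x = 0") (auto simp: zero_power)

end

section \<open>Sums of two elements of a multiplicative subgroup\<close>

locale finite_subfield_subgroup = finite_subfield K for K :: "'b::field set" +
  fixes H :: "'b set"
  assumes H_subset: "H \<subseteq> K - {0}" and one_mem_H: "1 \<in> H"
    and mult_mem_H: "x \<in> H \<Longrightarrow> y \<in> H \<Longrightarrow> x * y \<in> H"
    and inverse_mem_H: "x \<in> H \<Longrightarrow> inverse x \<in> H"
begin

lemma finite_H: "finite H"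
  using H_subset finite_K finite_subset by blast

lemma card_H_pos: "card H > 0"
  using finite_H one_mem_H by (auto simp: card_gt_0_iff)

lemma card_H_le: "card H \<le> card K - 1"
  using card_mono[OF _ H_subset] by (simp add: card_units)

definition index_H :: real where
  "index_H = real (card K - 1) / real (card H)"

lemma index_H_mult_card: "index_H * real (card H) = real (card K) - 1"
  using card_H_pos card_gt_1 by (simp add: index_H_def of_nat_diff)

lemma index_H_ge_1: "index_H \<ge> 1"
  using card_H_pos card_H_le by (simp add: index_H_def)

text \<open>
  If \<open>H\<close> consists of the nonzero \<open>d\<close>-th powers and has index \<open>d\<close>, then \<open>excess x + 1\<close> is the number
  of \<open>d\<close>-th roots of \<open>x\<close>, and \<open>twisted_conv excess c l\<close> is the deviation of the number of solutions
  of \<open>x ^ d / c + y ^ d = l\<close> from its expected value \<open>card K\<close>.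
\<close>

definition excess :: "'b \<Rightarrow> real" where
  "excess x = (if x = 0 then 0 else if x \<in> H then index_H - 1 else - 1)"

lemma sum_comp_excess:
  "(\<Sum>x\<in>K. F (excess x)) =
    F 0 + real (card H) * F (index_H - 1) + (real (card K) - 1 - real (card H)) * F (- 1)"
  for F :: "real \<Rightarrow> real"
proof -
  have "(\<Sum>x\<in>K. F (excess x)) = F (excess 0) + (\<Sum>x\<in>K - {0}. F (excess x))"
    by (simp add: sum.remove[of K 0])
  also have "(\<Sum>x\<in>K - {0}. F (excess x)) = (\<Sum>x\<in>K - {0} - H. F (excess x)) + (\<Sum>x\<in>H. F (excess x))"
    using H_subset by (intro sum.subset_diff) auto
  also have "(\<Sum>x\<in>H. F (excess x)) = (\<Sum>x\<in>H. F (index_H - 1))"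
    using H_subset by (intro sum.cong) (auto simp: excess_def)
  also have "(\<Sum>x\<in>K - {0} - H. F (excess x)) = (\<Sum>x\<in>K - {0} - H. F (- 1))"
    by (intro sum.cong) (auto simp: excess_def)
  finally have "(\<Sum>x\<in>K. F (excess x)) =
      F 0 + real (card H) * F (index_H - 1) + real (card (K - {0} - H)) * F (- 1)"
    by (simp add: excess_def)
  moreover have "card (K - {0} - H) = card K - 1 - card H"
    using card_Diff_subset[OF finite_H H_subset] by (simp add: card_units)
  ultimately show ?thesis using card_H_le card_gt_1 by (simp add: of_nat_diff)
qed

lemma sum_excess: "(\<Sum>x\<in>K. excess x) = 0"
  using sum_comp_excess[of "\<lambda>x. x"] index_H_mult_card by (simp add: algebra_simps)

lemma sum_excess_square: "(\<Sum>x\<in>K. (excess x)\<^sup>2) = real (card H) * index_H * (index_H - 1)"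
proof -
  have "(\<Sum>x\<in>K. (excess x)\<^sup>2) =
      real (card H) * (index_H - 1)\<^sup>2 + (index_H * real (card H) - real (card H))"
    using sum_comp_excess[of "\<lambda>x. x\<^sup>2"] index_H_mult_card by simp
  then show ?thesis by (simp add: power2_eq_square algebra_simps)
qed

lemma excess_mult_H:
  assumes u: "u \<in> H"
  shows "excess (u * x) = excess x"
proof -
  have "u \<noteq> 0" using u H_subset by auto
  moreover have "u * x \<in> H \<longleftrightarrow> x \<in> H"
    using mult_mem_H[OF u, of x] mult_mem_H[OF inverse_mem_H[OF u], of "u * x"] \<open>u \<noteq> 0\<close>
    by (auto simp: mult.assoc[symmetric])
  ultimately show ?thesis by (simp add: excess_def)
qed

lemma twisted_conv_excess_mult_H:
  assumes c: "c \<in> H" and u: "u \<in> H"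
  shows "twisted_conv excess c (l * u) = twisted_conv excess 1 l"
proof -
  have "u \<in> K - {0}" using u H_subset by auto
  then have "twisted_conv excess c (l * u) = (\<Sum>x\<in>K. excess (c * (u * x)) * excess (l * u - u * x))"
    unfolding twisted_conv_def by (rule sum_scale[symmetric])
  also have "\<dots> = (\<Sum>x\<in>K. excess (c * (u * x)) * excess (u * (l - x)))"
    by (simp add: right_diff_distrib mult.commute)
  also have "\<dots> = twisted_conv excess 1 l" using c u by (simp add: excess_mult_H twisted_conv_def)
  finally show ?thesis .
qed

lemma twisted_conv_excess_square_le:
  assumes l: "l \<in> K - {0}"
  shows "(twisted_conv excess 1 l)\<^sup>2 \<le> (index_H - 1) ^ 3 * ((index_H - 1) * real (card K) + 1)"
proof -
  define h Q d where "h = real (card H)" and "Q = real (card K)" and "d = index_H"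
  define V where "V = twisted_conv excess 1 l"
  have h: "h > 0" and d: "d \<ge> 1" and dh: "d * h = Q - 1" and Q: "Q > 1"
    using card_H_pos index_H_ge_1 index_H_mult_card card_gt_1 by (auto simp: h_def d_def Q_def)
  have l_H: "(*) l ` H \<subseteq> K" "inj_on ((*) l) H"
    using l H_subset by (auto intro: inj_onI)
  then have "(\<Sum>y\<in>(*) l ` H. twisted_conv excess c y) = h * V" if "c \<in> H" for c
    using that by (simp add: sum.reindex twisted_conv_excess_mult_H h_def V_def)
  then have "(\<Sum>c\<in>H. \<Sum>y\<in>(*) l ` H. twisted_conv excess c y) = h\<^sup>2 * V"
    by (simp add: h_def power2_eq_square)
  moreover have "(\<Sum>c\<in>K - {0}. \<Sum>y\<in>K. (twisted_conv excess c y)\<^sup>2) = Q * (h * d * (d - 1))\<^sup>2"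
    using twisted_conv_second_moment[OF sum_excess] by (simp add: sum_excess_square h_def d_def Q_def)
  moreover have "real (card (K - {0})) = d * h" "real (card ((*) l ` H)) = h"
    using card_gt_1 l_H(2) dh by (simp_all add: card_units card_image h_def Q_def of_nat_diff)
  ultimately have "(h\<^sup>2 * V)\<^sup>2 \<le> Q * (h * d * (d - 1))\<^sup>2 * (h * (1 - h / (d * h)) * (h * (1 - h / Q)))"
    using rectangle_sum_square_le[OF _ H_subset finite_K l_H(1), of "twisted_conv excess"]
      sum_twisted_conv[OF sum_excess] sum_twists_twisted_conv[OF _ sum_excess]
    by (simp add: excess_def h_def Q_def)
  also have "\<dots> = h ^ 4 * ((d - 1) ^ 3 * (d * Q - d * h))"
    using d h Q by (simp add: field_simps power2_eq_square power3_eq_cube power4_eq_xxxx)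
  also have "d * Q - d * h = (d - 1) * Q + 1" using dh by (simp add: algebra_simps)
  finally have "h ^ 4 * V\<^sup>2 \<le> h ^ 4 * ((d - 1) ^ 3 * ((d - 1) * Q + 1))"
    by (simp add: power_mult_distrib flip: power_mult)
  then show ?thesis using h by (simp add: V_def d_def Q_def)
qed

lemma twisted_conv_excess_of_not_sum:
  assumes l: "l \<in> K" and not_sum: "\<And>x y. x \<in> insert 0 H \<Longrightarrow> y \<in> insert 0 H \<Longrightarrow> x + y \<noteq> l"
  shows "twisted_conv excess 1 l = - real (card K)"
proof -
  have "(1 + excess x) * (1 + excess (l - x)) = 0" if "x \<in> K" for x
    using not_sum[of x "l - x"] by (auto simp: excess_def)
  then have "(\<Sum>x\<in>K. (1 + excess x) * (1 + excess (l - x))) = 0" by (rule sum.neutral[OF ballI])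
  moreover have "(\<Sum>x\<in>K. (1 + excess x) * (1 + excess (l - x))) =
      real (card K) + (\<Sum>x\<in>K. excess (l - x)) + (\<Sum>x\<in>K. excess x) + twisted_conv excess 1 l"
    by (simp add: twisted_conv_def algebra_simps sum.distrib)
  ultimately show ?thesis using sum_excess sum_reflect[OF l, of excess] by simp
qed

lemma unit_eq_sum_of_two:
  assumes index: "index_H \<le> real k" and large: "card K > (k - 1) ^ 4" and l: "l \<in> K - {0}"
  shows "\<exists>x\<in>insert 0 H. \<exists>y\<in>insert 0 H. x + y = l"
proof (rule ccontr)
  assume not_sum: "\<not> ?thesis"
  have "twisted_conv excess 1 l = - real (card K)"
    by (rule twisted_conv_excess_of_not_sum) (use l not_sum in blast)+
  then have square: "(twisted_conv excess 1 l)\<^sup>2 = (real (card K))\<^sup>2" by simp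
  define Q m where "Q = real (card K)" and "m = real (k - 1)"
  have "k \<ge> 1" using index index_H_ge_1 by linarith
  then have m: "index_H - 1 \<le> m" "0 \<le> m" using index by (auto simp: m_def of_nat_diff)
  have "m ^ 3 \<le> m ^ 4"
    by (cases "k - 1 = 0") (auto simp: m_def intro: power_increasing)
  have "real ((k - 1) ^ 4 + 1) \<le> real (card K)" using large by (intro of_nat_mono) simp
  then have Q: "m ^ 4 + 1 \<le> Q" by (simp add: Q_def m_def)
  then have "Q > 0" by (smt (verit) zero_le_power m(2))
  have "Q\<^sup>2 \<le> (index_H - 1) ^ 3 * ((index_H - 1) * Q + 1)"
    using twisted_conv_excess_square_le[OF l] square by (simp add: Q_def)
  also have "\<dots> \<le> m ^ 3 * (m * Q + 1)"
    using m index_H_ge_1 \<open>Q > 0\<close> by (intro mult_mono power_mono add_mono mult_right_mono) auto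
  also have "\<dots> = m ^ 4 * Q + m ^ 3" by (simp add: algebra_simps power3_eq_cube power4_eq_xxxx)
  also have "\<dots> < m ^ 4 * Q + Q" using \<open>m ^ 3 \<le> m ^ 4\<close> Q by linarith
  also have "\<dots> = (m ^ 4 + 1) * Q" by (simp add: algebra_simps)
  also have "\<dots> \<le> Q\<^sup>2" unfolding power2_eq_square using Q \<open>Q > 0\<close> by (intro mult_right_mono) auto
  finally show False by simp
qed

end

section \<open>Powers in a finite field\<close>

lemma
  fixes a :: "'b::field"
  assumes "k \<ge> 1"
  shows finite_nth_roots: "finite {x. x ^ k = a}" and card_nth_roots_le: "card {x. x ^ k = a} \<le> k"
proof -
  let ?p = "monom 1 k - [:a:]"
  have "coeff ?p k \<noteq> 0" using assms by (simp add: coeff_pCons split: nat.splits)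
  then have p: "?p \<noteq> 0" by (metis coeff_0)
  have roots: "{x. poly ?p x = 0} = {x. x ^ k = a}" by (simp add: poly_monom)
  show "finite {x. x ^ k = a}" using poly_roots_finite[OF p] roots by simp
  have "degree ?p \<le> k" by (intro degree_diff_le) (auto simp: degree_monom_eq)
  then show "card {x. x ^ k = a} \<le> k" using card_poly_roots_bound[OF p] roots by simp
qed

lemma card_le_mult_card_image:
  assumes "finite A" and fibres: "\<And>b. b \<in> f ` A \<Longrightarrow> card {a \<in> A. f a = b} \<le> k"
  shows "card A \<le> k * card (f ` A)"
proof -
  have "A = (\<Union>b\<in>f ` A. {a \<in> A. f a = b})" by auto
  then have "card A \<le> (\<Sum>b\<in>f ` A. card {a \<in> A. f a = b})"
    using card_UN_le[of "f ` A" "\<lambda>b. {a \<in> A. f a = b}"] assms(1) by simp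
  also have "\<dots> \<le> (\<Sum>b\<in>f ` A. k)" by (intro sum_mono fibres)
  finally show ?thesis by (simp add: mult.commute)
qed

definition nonzero_powers :: "'b::field set \<Rightarrow> nat \<Rightarrow> 'b set" where
  "nonzero_powers K k = (\<lambda>x. x ^ k) ` (K - {0})"

lemma card_le_mult_card_nonzero_powers:
  assumes "finite K" "k \<ge> 1"
  shows "card (K - {0}) \<le> k * card (nonzero_powers K k)"
  unfolding nonzero_powers_def
proof (rule card_le_mult_card_image)
  fix a assume "a \<in> (\<lambda>x. x ^ k) ` (K - {0})"
  have "card {x \<in> K - {0}. x ^ k = a} \<le> card {x. x ^ k = a}"
    by (intro card_mono finite_nth_roots assms) auto
  then show "card {x \<in> K - {0}. x ^ k = a} \<le> k" using card_nth_roots_le[OF assms(2), of a] by simp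
qed (use assms in auto)

context finite_subfield
begin

lemma finite_subfield_subgroup_nonzero_powers: "finite_subfield_subgroup K (nonzero_powers K k)"
proof
  show "1 \<in> nonzero_powers K k" unfolding nonzero_powers_def by (rule image_eqI[of _ _ 1]) auto
  show "x * y \<in> nonzero_powers K k" if "x \<in> nonzero_powers K k" "y \<in> nonzero_powers K k" for x y
    using that by (auto simp: nonzero_powers_def power_mult_distrib[symmetric])
  show "inverse x \<in> nonzero_powers K k" if "x \<in> nonzero_powers K k" for x
    using that by (auto simp: nonzero_powers_def power_inverse[symmetric])
qed (auto simp: nonzero_powers_def)

lemma nonzero_powers_gcd:
  assumes k: "k \<ge> 1"
  shows "nonzero_powers K (gcd k (card K - 1)) = nonzero_powers K k"
proof
  let ?d = "gcd k (card K - 1)"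
  show "nonzero_powers K ?d \<subseteq> nonzero_powers K k"
  proof
    fix z assume "z \<in> nonzero_powers K ?d"
    then obtain x where x: "x \<in> K - {0}" "z = x ^ ?d" by (auto simp: nonzero_powers_def)
    obtain a b where ab: "k * a = (card K - 1) * b + ?d"
      using bezout_nat[of k "card K - 1"] k by auto
    have "(x ^ a) ^ k = (x ^ (card K - 1)) ^ b * x ^ ?d"
      by (simp only: ab mult.commute[of a k] flip: power_mult power_add)
    then have "z = (x ^ a) ^ k" using power_card_minus_one[OF x(1)] x(2) by simp
    then show "z \<in> nonzero_powers K k" using x(1) by (auto simp: nonzero_powers_def)
  qed
  obtain e where "k = e * ?d" using gcd_dvd1[of k "card K - 1"] by (metis dvdE mult.commute)
  then have "x ^ k = (x ^ e) ^ ?d" for x :: 'b by (simp flip: power_mult)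
  then show "nonzero_powers K k \<subseteq> nonzero_powers K ?d" by (auto simp: nonzero_powers_def)
qed

lemma card_le_gcd_mult_card_nonzero_powers:
  assumes k: "k \<ge> 1"
  shows "card K - 1 \<le> gcd k (card K - 1) * card (nonzero_powers K k)"
proof -
  have "gcd k (card K - 1) \<ge> 1" using k by (simp add: Suc_le_eq)
  then show ?thesis
    using card_le_mult_card_nonzero_powers[OF finite_K] by (metis card_units nonzero_powers_gcd[OF k])
qed

lemma card_powers_square_gt:
  assumes k: "k \<ge> 1" and large: "(gcd k (card K - 1))\<^sup>2 < card K"
  shows "(card (insert 0 (nonzero_powers K k)))\<^sup>2 > card K"
proof -
  define d h where "d = gcd k (card K - 1)" and "h = card (nonzero_powers K k)"
  have d: "d \<ge> 1" using k by (simp add: d_def Suc_le_eq)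
  have dh: "card K - 1 \<le> d * h"
    using card_le_gcd_mult_card_nonzero_powers[OF k] by (simp add: d_def h_def)
  moreover have "d * d \<le> card K - 1" using large by (simp add: d_def power2_eq_square)
  ultimately have "d * d \<le> d * h" by (rule order.trans[rotated])
  then have "d \<le> h" using d by simp
  then have "card K - 1 \<le> h * h" using dh by (meson le_trans mult_le_mono1)
  then have "card K < (h + 1) * (h + 1)" using d \<open>d \<le> h\<close> by (simp add: algebra_simps)
  moreover have "0 \<notin> nonzero_powers K k" using k by (auto simp: nonzero_powers_def)
  then have "card (insert 0 (nonzero_powers K k)) = h + 1"
    by (simp add: h_def nonzero_powers_def)
  ultimately show ?thesis by (simp only: power2_eq_square)
qed

lemma sum_of_two_powers:
  assumes k: "k \<ge> 1" and large: "card K > (k - 1) ^ 4" and l: "l \<in> K"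
  shows "\<exists>x\<in>K. \<exists>y\<in>K. l = x ^ k + y ^ k"
proof (cases "l = 0")
  case True
  then show ?thesis using k by (intro bexI[of _ 0]) (auto simp: zero_power)
next
  case False
  interpret finite_subfield_subgroup K "nonzero_powers K k"
    by (rule finite_subfield_subgroup_nonzero_powers)
  have "real (card K - 1) \<le> real (k * card (nonzero_powers K k))"
    using card_le_mult_card_nonzero_powers[OF finite_K k] by (simp only: card_units of_nat_le_iff)
  then have "index_H \<le> real k"
    using card_H_pos by (simp add: index_H_def divide_simps)
  then obtain x y where "x \<in> insert 0 (nonzero_powers K k)" "y \<in> insert 0 (nonzero_powers K k)" "x + y = l"
    using unit_eq_sum_of_two[OF _ large, of l] l False by blast
  moreover have "\<exists>w\<in>K. z = w ^ k" if "z \<in> insert 0 (nonzero_powers K k)" for z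
    using that k by (auto simp: nonzero_powers_def zero_power intro: bexI[of _ 0])
  ultimately show ?thesis by metis
qed

lemma exists_root_of_unity_nonzero_powers:
  assumes k: "k \<ge> 1" and r: "r \<ge> 2" "r dvd (card K - 1) div gcd k (card K - 1)"
  shows "\<exists>z\<in>nonzero_powers K k. z \<noteq> 1 \<and> z ^ r = 1"
proof -
  define d where "d = gcd k (card K - 1)"
  obtain e where "(card K - 1) div d = r * e" using r(2) unfolding d_def by blast
  then have units: "card K - 1 = r * (d * e)"
    using dvd_mult_div_cancel[of d "card K - 1"] by (simp add: d_def mult_ac)
  then have de: "d * e \<ge> 1" using card_gt_1 by (cases "d * e") auto
  have "\<exists>w\<in>K - {0}. w ^ (d * e) \<noteq> 1"
  proof (rule ccontr)
    assume "\<not> ?thesis"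
    then have "K - {0} \<subseteq> {x. x ^ (d * e) = 1}" by auto
    then have "card (K - {0}) \<le> d * e"
      using card_mono[OF finite_nth_roots[OF de]] card_nth_roots_le[OF de] le_trans by blast
    then have "r * (d * e) \<le> d * e" unfolding card_units units .
    then show False using r(1) de by simp
  qed
  then obtain w where w: "w \<in> K - {0}" "w ^ (d * e) \<noteq> 1" by blast
  have "(w ^ e) ^ d \<in> nonzero_powers K d" using w(1) by (auto simp: nonzero_powers_def)
  then have "w ^ (d * e) \<in> nonzero_powers K k"
    using nonzero_powers_gcd[OF k] by (simp add: d_def mult.commute flip: power_mult)
  moreover have "(w ^ (d * e)) ^ r = 1"
    using power_card_minus_one[OF w(1)] unfolding units by (simp add: mult.commute flip: power_mult)
  ultimately show ?thesis using w(2) by blast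
qed

end

section \<open>Finite subfields of algebraically closed fields\<close>

lemma proots_prod_mset_linear:
  fixes A :: "'a::idom multiset"
  shows "proots (\<Prod>x\<in>#A. [:- x, 1:]) = A"
proof (induction A)
  case (add a A)
  have "(\<Prod>x\<in>#A. [:- x, 1:]) \<noteq> 0" by (auto simp: prod_mset_zero_iff)
  then show ?case using add by (simp add: proots_mult del: mult_pCons_left)
qed simp

lemma size_proots_alg_closed: "size (proots p) = degree p"
  for p :: "'a::alg_closed_field poly"
proof (cases "p = 0")
  case False
  then obtain A c where A: "size A = degree p" "p = smult c (\<Prod>x\<in>#A. [:- x, 1:])"
    using alg_closed_imp_factorization by blast
  have "c \<noteq> 0" using False by (subst (asm) A(2)) simp
  then have "proots p = A" by (subst A(2)) (simp add: proots_prod_mset_linear)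
  then show ?thesis using A(1) by simp
qed simp

lemma order_le_1_if_pderiv_nonzero:
  fixes p :: "'a::idom poly"
  assumes "poly (pderiv p) a \<noteq> 0"
  shows "order a p \<le> 1"
proof (rule ccontr)
  assume "\<not> ?thesis"
  then have "[:- a, 1:] ^ 2 dvd p"
    by (simp add: order_divides)
  then obtain q where "p = [:- a, 1:] * ([:- a, 1:] * q)"
    by (metis dvdE mult.assoc power2_eq_square)
  then have "poly (pderiv p) a = 0" by (simp only: pderiv_mult poly_add poly_mult) simp
  then show False using assms by simp
qed

lemma card_roots_separable:
  fixes p :: "'a::alg_closed_field poly"
  assumes separable: "\<And>x. poly p x = 0 \<Longrightarrow> poly (pderiv p) x \<noteq> 0"
  shows "card {x. poly p x = 0} = degree p"
proof -
  have p: "p \<noteq> 0" using separable by fastforce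
  have "count (proots p) x = 1" if "poly p x = 0" for x
    using order_le_1_if_pderiv_nonzero[OF separable[OF that]] that p order_root[of p x] by simp
  then have "size (proots p) = card {x. poly p x = 0}"
    using p by (simp add: size_multiset_overloaded_eq)
  then show ?thesis by (simp add: size_proots_alg_closed)
qed

definition frobenius_fixed_points :: "nat \<Rightarrow> 'b::field set" where
  "frobenius_fixed_points m = {x. x ^ (CHAR('b) ^ m) = x}"

lemma card_frobenius_fixed_points:
  assumes char: "prime CHAR('b::alg_closed_field)" and m: "m \<ge> 1"
  shows "card (frobenius_fixed_points m :: 'b set) = CHAR('b) ^ m"
proof -
  let ?Q = "CHAR('b) ^ m" and ?p = "monom 1 (CHAR('b) ^ m) - [:0, 1 :: 'b:]"
  have Q: "?Q > 1" using char m by (metis One_nat_def Suc_le_eq one_less_power prime_gt_1_nat)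
  have "of_nat ?Q = (0 :: 'b)" using m by (simp add: zero_power)
  then have "pderiv ?p = - 1"
    by (simp add: pderiv_diff pderiv_monom pderiv_pCons one_pCons zero_power)
  then have "card {x. poly ?p x = 0} = degree ?p" by (intro card_roots_separable) simp
  moreover have "degree ?p = ?Q"
    using Q degree_add_eq_left[of "- [:0, 1 :: 'b:]" "monom 1 ?Q"]
    by (simp only: diff_conv_add_uminus) (simp add: degree_monom_eq)
  ultimately show ?thesis by (simp add: frobenius_fixed_points_def poly_monom)
qed

lemma finite_subfield_frobenius_fixed_points:
  assumes char: "prime CHAR('b::alg_closed_field)" and m: "m \<ge> 1"
  shows "finite_subfield (frobenius_fixed_points m :: 'b set)"
proof
  let ?K = "frobenius_fixed_points m :: 'b set" and ?Q = "CHAR('b) ^ m"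
  have Q: "?Q > 0" using char prime_gt_0_nat by simp
  show "finite ?K"
    using card_frobenius_fixed_points[OF assms] Q by (metis card.infinite less_numeral_extra(3))
  have add: "(x + y) ^ ?Q = x ^ ?Q + y ^ ?Q" for x y :: 'b
    using freshmans_dream'[of ?Q m x y] char by simp
  then show "x + y \<in> ?K" if "x \<in> ?K" "y \<in> ?K" for x y
    using that by (simp add: frobenius_fixed_points_def)
  show "- x \<in> ?K" if "x \<in> ?K" for x
  proof -
    have "x ^ ?Q + (- x) ^ ?Q = 0" using add[of x "- x"] Q by (simp add: zero_power)
    then show ?thesis
      using that by (simp add: frobenius_fixed_points_def eq_neg_iff_add_eq_0 add.commute)
  qed
qed (use char in \<open>auto simp: frobenius_fixed_points_def power_mult_distrib power_inverse
  zero_power prime_gt_0_nat\<close>)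

section \<open>Matrix representations of commutative algebras\<close>

context vector_space
begin

lemma representation_combination:
  assumes finite: "finite B" and independent: "independent B" and c: "c \<in> B"
  shows "representation B (\<Sum>b\<in>B. scale (u b) b) c = u c"
proof -
  have "representation B (\<Sum>b\<in>B. scale (u b) b) c = (\<Sum>b\<in>B. u b * representation B b c)"
    using independent by (simp add: representation_sum representation_scale span_scale span_base)
  also have "\<dots> = (\<Sum>b\<in>B. if b = c then u b else 0)"
    using independent by (intro sum.cong) (auto simp: representation_basis)
  finally show ?thesis using finite c by simp
qed

lemma card_span_independent:
  assumes finite: "finite B" and independent: "independent B"
  shows "card (span B) = CARD('a) ^ card B"
proof -
  let ?coords = "\<lambda>x. restrict (representation B x) B" and ?combination = "\<lambda>u. \<Sum>b\<in>B. scale (u b) b"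
  have "bij_betw ?coords (span B) (B \<rightarrow>\<^sub>E UNIV)"
  proof (rule bij_betwI[of _ _ _ ?combination])
    show "?combination \<in> (B \<rightarrow>\<^sub>E UNIV) \<rightarrow> span B"
      by (auto intro: span_sum span_scale span_base)
    show "?combination (?coords x) = x" if "x \<in> span B" for x
      using sum_representation_eq[OF independent that finite] by simp
    show "?coords (?combination u) = u" if "u \<in> B \<rightarrow>\<^sub>E UNIV" for u
      using that representation_combination[OF finite independent, of _ u]
      by (auto simp: fun_eq_iff PiE_def extensional_def)
  qed auto
  then have "card (span B) = card (B \<rightarrow>\<^sub>E (UNIV :: 'a set))" by (rule bij_betw_same_card)
  then show ?thesis by (simp add: card_funcsetE finite)
qed

end

locale algebra_basis = vector_space scale
  for scale :: "'a::field \<Rightarrow> 'b::comm_ring_1 \<Rightarrow> 'b" +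
  fixes bs :: "'b list"
  assumes scale_mult: "scale a x * y = scale a (x * y)"
    and distinct_bs: "distinct bs" and independent_bs: "independent (set bs)"
    and one_mem_span: "1 \<in> span (set bs)"
    and mult_mem_span: "x \<in> span (set bs) \<Longrightarrow> y \<in> span (set bs) \<Longrightarrow> x * y \<in> span (set bs)"
begin

definition coord :: "'b \<Rightarrow> nat \<Rightarrow> 'a" where
  "coord x i = representation (set bs) x (bs ! i)"

definition mult_mat :: "'b \<Rightarrow> 'a mat" where
  "mult_mat x = mat (length bs) (length bs) (\<lambda>(i, j). coord (x * bs ! j) i)"

lemma nth_mem_span: "i < length bs \<Longrightarrow> bs ! i \<in> span (set bs)"
  by (simp add: span_base)

lemma power_mem_span: "x \<in> span (set bs) \<Longrightarrow> x ^ k \<in> span (set bs)"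
  by (induction k) (auto intro: one_mem_span mult_mem_span)

lemma coord_add:
  "x \<in> span (set bs) \<Longrightarrow> y \<in> span (set bs) \<Longrightarrow> coord (x + y) i = coord x i + coord y i"
  by (simp add: coord_def representation_add[OF independent_bs])

lemma coord_scale: "x \<in> span (set bs) \<Longrightarrow> coord (scale a x) i = a * coord x i"
  by (simp add: coord_def representation_scale[OF independent_bs])

lemma coord_sum:
  "(\<And>j. j \<in> J \<Longrightarrow> f j \<in> span (set bs)) \<Longrightarrow> coord (\<Sum>j\<in>J. f j) i = (\<Sum>j\<in>J. coord (f j) i)"
  by (simp add: coord_def representation_sum[OF independent_bs])

lemma coord_nth: "i < length bs \<Longrightarrow> j < length bs \<Longrightarrow> coord (bs ! j) i = (if i = j then 1 else 0)"
  using distinct_bs by (simp add: coord_def representation_basis[OF independent_bs] nth_eq_iff_index_eq)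

lemma sum_coord:
  assumes "x \<in> span (set bs)"
  shows "(\<Sum>i<length bs. scale (coord x i) (bs ! i)) = x"
proof -
  have "(\<Sum>i<length bs. scale (coord x i) (bs ! i)) = (\<Sum>b\<in>set bs. scale (representation (set bs) x b) b)"
    unfolding coord_def using distinct_bs by (intro sum.reindex_bij_betw bij_betw_nth) auto
  then show ?thesis using sum_representation_eq[OF independent_bs assms] by simp
qed

lemma mult_mat_carrier [simp]: "mult_mat x \<in> carrier_mat (length bs) (length bs)"
  by (simp add: mult_mat_def)

lemma mult_mat_add:
  "x \<in> span (set bs) \<Longrightarrow> y \<in> span (set bs) \<Longrightarrow> mult_mat (x + y) = mult_mat x + mult_mat y"
  by (intro eq_matI) (auto simp: mult_mat_def distrib_right coord_add mult_mem_span nth_mem_span)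

lemma mult_mat_scale_one: "mult_mat (scale a 1) = a \<cdot>\<^sub>m 1\<^sub>m (length bs)"
  by (intro eq_matI) (auto simp: mult_mat_def scale_mult coord_scale coord_nth nth_mem_span)

lemma mult_mat_mult:
  assumes x: "x \<in> span (set bs)" and y: "y \<in> span (set bs)"
  shows "mult_mat (x * y) = mult_mat x * mult_mat y"
proof (rule eq_matI)
  fix i j assume "i < dim_row (mult_mat x * mult_mat y)" "j < dim_col (mult_mat x * mult_mat y)"
  then have ij: "i < length bs" "j < length bs" by (auto simp: mult_mat_def)
  have "x * y * bs ! j = x * (\<Sum>l<length bs. scale (coord (y * bs ! j) l) (bs ! l))"
    using sum_coord y ij by (simp add: mult_mem_span nth_mem_span mult.assoc)
  also have "\<dots> = (\<Sum>l<length bs. scale (coord (y * bs ! j) l) (x * bs ! l))"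
    by (simp add: sum_distrib_left scale_mult mult.commute[of x])
  finally have "coord (x * y * bs ! j) i = coord (\<Sum>l<length bs. scale (coord (y * bs ! j) l) (x * bs ! l)) i"
    by simp
  also have "\<dots> = (\<Sum>l<length bs. coord (scale (coord (y * bs ! j) l) (x * bs ! l)) i)"
    using x by (intro coord_sum span_scale mult_mem_span nth_mem_span) auto
  also have "\<dots> = (\<Sum>l<length bs. coord (y * bs ! j) l * coord (x * bs ! l) i)"
    using x by (intro sum.cong coord_scale mult_mem_span nth_mem_span) auto
  finally have "coord (x * y * bs ! j) i = (\<Sum>l<length bs. coord (y * bs ! j) l * coord (x * bs ! l) i)" .
  then show "mult_mat (x * y) $$ (i, j) = (mult_mat x * mult_mat y) $$ (i, j)"
    using ij by (simp add: mult_mat_def scalar_prod_def atLeast0LessThan mult.commute)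
qed (auto simp: mult_mat_def)

lemma mult_mat_power:
  assumes x: "x \<in> span (set bs)"
  shows "mult_mat (x ^ k) = mult_mat x ^\<^sub>m k"
proof (induction k)
  case 0
  then show ?case using mult_mat_scale_one[of 1] carrier_matD(1)[OF mult_mat_carrier[of x]]
    by (auto intro: eq_matI)
next
  case (Suc k)
  then show ?case using mult_mat_mult[OF power_mem_span[OF x, of k] x] by (simp add: mult.commute)
qed

lemma scalar_mat_is_sum_of_two_powers:
  assumes "x \<in> span (set bs)" "y \<in> span (set bs)" and "scale a 1 = x ^ k + y ^ k"
  shows "is_sum_of_two_powers k (a \<cdot>\<^sub>m 1\<^sub>m (length bs))"
proof (rule is_sum_of_two_powersI[OF mult_mat_carrier mult_mat_carrier])
  show "a \<cdot>\<^sub>m 1\<^sub>m (length bs) = mult_mat x ^\<^sub>m k + mult_mat y ^\<^sub>m k"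
    using assms mult_mat_add[of "x ^ k" "y ^ k"]
    by (simp add: power_mem_span mult_mat_power flip: mult_mat_scale_one)
qed

end

section \<open>Scalar matrices over a finite field\<close>

interpretation finite_field: finite_subfield "UNIV :: 'a::{field,finite} set"
  by unfold_locales auto

lemma CHAR_finite_field:
  assumes "prime p" "CARD('a::{field,finite}) = p ^ l"
  shows "CHAR('a) = p"
proof -
  have "(\<Sum>x\<in>(UNIV :: 'a set). x) = (\<Sum>x\<in>UNIV. x + 1)"
    using finite_field.sum_translate[of "- 1" "\<lambda>x. x"] by (simp add: eq_commute)
  then have "of_nat (p ^ l) = (0 :: 'a)" using assms(2) by (simp add: sum.distrib)
  then have "of_nat p = (0 :: 'a)" by simp
  then have "CHAR('a) dvd p" using of_nat_eq_0_iff_char_dvd by blast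
  then show ?thesis using assms(1) by (metis CHAR_not_1' One_nat_def prime_nat_iff)
qed

interpretation to_ac_vs: vector_space "\<lambda>(a :: 'a::field) x. to_ac a * x"
  by unfold_locales (auto simp: algebra_simps)

lemma exists_finite_extension:
  assumes p: "prime p" "CARD('a) = p ^ e" and n: "n \<ge> 1"
  obtains K :: "'a::{field,finite} alg_closure set"
  where "finite_subfield K" "range to_ac \<subseteq> K" "card K = CARD('a) ^ n"
proof
  let ?K = "frobenius_fixed_points (e * n) :: 'a alg_closure set"
  have char: "CHAR('a alg_closure) = p" using CHAR_finite_field[OF p] by simp
  have "e \<noteq> 0" using finite_field.card_gt_1[where 'a = 'a] p(2) by (intro notI) simp
  then have en: "e * n \<ge> 1" using n by (simp add: Suc_le_eq)
  show "finite_subfield ?K"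
    using finite_subfield_frobenius_fixed_points[OF _ en, where 'b = "'a alg_closure"] p(1) char by simp
  have exponent: "CHAR('a alg_closure) ^ (e * n) = CARD('a) ^ n"
    by (simp only: char p(2) power_mult)
  show "card ?K = CARD('a) ^ n"
    using card_frobenius_fixed_points[OF _ en, where 'b = "'a alg_closure"] p(1) char exponent by simp
  have "a ^ (CARD('a) ^ n) = a" for a :: 'a
    by (induction n) (simp_all add: power_mult finite_field.power_card)
  then show "range to_ac \<subseteq> ?K"
    unfolding frobenius_fixed_points_def exponent by (auto simp flip: to_ac_power)
qed

lemma finite_extension_basis:
  fixes K :: "'a::{field,finite} alg_closure set"
  assumes K: "finite_subfield K" and extension: "range to_ac \<subseteq> K" and card: "card K = CARD('a) ^ n"
  obtains bs where "algebra_basis (\<lambda>a x. to_ac a * x) bs" "to_ac_vs.span (set bs) = K" "length bs = n"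
proof -
  interpret finite_subfield K by fact
  obtain B where B: "B \<subseteq> K" "to_ac_vs.independent B" "K \<subseteq> to_ac_vs.span B"
    using to_ac_vs.maximal_independent_subset by blast
  have "finite B" using B(1) finite_K finite_subset by blast
  then obtain bs where bs: "set bs = B" "distinct bs" using finite_distinct_list by blast
  have "to_ac_vs.subspace K"
    using extension by (auto simp: to_ac_vs.subspace_def image_subset_iff)
  then have span: "to_ac_vs.span (set bs) = K"
    using B bs to_ac_vs.span_minimal by blast
  have "CARD('a) ^ card B = CARD('a) ^ n"
    using to_ac_vs.card_span_independent[OF \<open>finite B\<close> B(2)] span bs card by simp
  then have "card B = n" using finite_field.card_gt_1[where 'a = 'a] by simp
  then have "length bs = n" using bs distinct_card by metis
  moreover have "algebra_basis (\<lambda>a x. to_ac a * x) bs"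
    by unfold_locales (use bs B(2) in \<open>auto simp: span mult.assoc\<close>)
  ultimately show ?thesis using that span by blast
qed

lemma scalar_mat_is_sum_of_two_powers:
  fixes a :: "'a::{field,finite}"
  assumes p: "prime p" "CARD('a) = p ^ e" and n: "n \<ge> 1" and k: "k \<ge> 1"
    and large: "(k - 1) ^ 4 < CARD('a) ^ n"
  shows "is_sum_of_two_powers k (a \<cdot>\<^sub>m 1\<^sub>m n)"
proof -
  obtain K :: "'a alg_closure set"
    where K: "finite_subfield K" and extension: "range to_ac \<subseteq> K" and card: "card K = CARD('a) ^ n"
    using exists_finite_extension[OF p n] .
  obtain bs where bs: "algebra_basis (\<lambda>a x. to_ac a * x) bs" "to_ac_vs.span (set bs) = K" "length bs = n"
    using finite_extension_basis[OF K extension card] .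
  have "to_ac a \<in> K" using extension by blast
  then obtain x y where "x \<in> K" "y \<in> K" "to_ac a = x ^ k + y ^ k"
    using finite_subfield.sum_of_two_powers[OF K k] large card by metis
  then show ?thesis
    using algebra_basis.scalar_mat_is_sum_of_two_powers[OF bs(1), of x y a k] bs(2,3) by simp
qed

section \<open>Large sets in finite fields\<close>

definition collisions :: "('a \<Rightarrow> 'b) \<Rightarrow> 'a set \<Rightarrow> ('a \<times> 'a) set" where
  "collisions f S = {(s, t) \<in> S \<times> S. f s = f t}"

lemma card_square_le_card_image_mult_collisions:
  assumes "finite S"
  shows "(card S)\<^sup>2 \<le> card (f ` S) * card (collisions f S)"
proof -
  let ?fibre = "\<lambda>y. {s \<in> S. f s = y}"
  have S: "card S = (\<Sum>y\<in>f ` S. card (?fibre y))"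
    using sum.group[of S "f ` S" f "\<lambda>_. 1 :: nat"] assms by simp
  have "collisions f S = (\<Union>y\<in>f ` S. ?fibre y \<times> ?fibre y)" by (auto simp: collisions_def)
  then have "card (collisions f S) = (\<Sum>y\<in>f ` S. card (?fibre y \<times> ?fibre y))"
    using assms by (simp only:) (subst card_UN_disjoint, auto)
  then have pairs: "card (collisions f S) = (\<Sum>y\<in>f ` S. (card (?fibre y))\<^sup>2)"
    by (simp add: card_cartesian_product power2_eq_square)
  have "(\<Sum>y\<in>f ` S. 1 * real (card (?fibre y)))\<^sup>2 \<le> (\<Sum>y\<in>f ` S. 1\<^sup>2) * (\<Sum>y\<in>f ` S. (real (card (?fibre y)))\<^sup>2)"
    by (rule Cauchy_Schwarz_ineq_sum)
  then have "real ((card S)\<^sup>2) \<le> real (card (f ` S) * card (collisions f S))"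
    unfolding S pairs by simp
  then show ?thesis by (simp only: of_nat_le_iff)
qed

definition dilate_sum :: "'a::semiring_1 \<Rightarrow> 'a \<times> 'a \<Rightarrow> 'a" where
  "dilate_sum u = (\<lambda>(a, b). a + u * b)"

lemma card_dilate_sum_eq_le_1:
  fixes s t :: "'a::field \<times> 'a"
  assumes "s \<noteq> t"
  shows "card {u. dilate_sum u s = dilate_sum u t} \<le> 1"
proof -
  obtain a b c d where st: "s = (a, b)" "t = (c, d)" by fastforce
  have "u = v" if "dilate_sum u s = dilate_sum u t" "dilate_sum v s = dilate_sum v t" for u v
  proof -
    have "a - c = u * (d - b)" "a - c = v * (d - b)"
      using that by (simp_all add: st dilate_sum_def algebra_simps)
    then show ?thesis using assms st by (cases "d = b") auto
  qed
  then have "{u. dilate_sum u s = dilate_sum u t} = {} \<or> (\<exists>u. {u. dilate_sum u s = dilate_sum u t} = {u})"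
    by blast
  then show ?thesis by auto
qed

lemma sum_card_collisions_dilate_sum_le:
  fixes S :: "('a::{field,finite} \<times> 'a) set"
  shows "(\<Sum>u\<in>UNIV. card (collisions (dilate_sum u) S)) \<le> (card S)\<^sup>2 + card S * (CARD('a) - 1)"
proof -
  let ?solutions = "\<lambda>x. card {u. dilate_sum u (fst x) = dilate_sum u (snd x)}"
  have "collisions (dilate_sum u) S = {x \<in> S \<times> S. dilate_sum u (fst x) = dilate_sum u (snd x)}" for u
    by (auto simp: collisions_def)
  then have "(\<Sum>u\<in>UNIV. card (collisions (dilate_sum u) S)) = (\<Sum>x\<in>S \<times> S. ?solutions x)"
    using sum_multicount_gen[of "UNIV :: 'a set" "S \<times> S"
        "\<lambda>u x. dilate_sum u (fst x) = dilate_sum u (snd x)" ?solutions] by simp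
  also have "\<dots> \<le> (\<Sum>x\<in>S \<times> S. 1 + (if fst x = snd x then CARD('a) - 1 else 0))"
  proof (rule sum_mono)
    fix x :: "('a \<times> 'a) \<times> ('a \<times> 'a)"
    show "?solutions x \<le> 1 + (if fst x = snd x then CARD('a) - 1 else 0)"
      using card_dilate_sum_eq_le_1[of "fst x" "snd x"] by (cases "fst x = snd x") auto
  qed
  also have "\<dots> = card (S \<times> S) + (\<Sum>x\<in>S \<times> S. if fst x = snd x then CARD('a) - 1 else 0)"
    unfolding sum.distrib by simp
  also have "(\<Sum>x\<in>S \<times> S. if fst x = snd x then CARD('a) - 1 else 0) = card S * (CARD('a) - 1)"
    by (simp add: sum.cartesian_product')
  finally show ?thesis by (simp add: card_cartesian_product power2_eq_square)
qed

lemma exists_large_dilate_sum_image: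
  fixes S :: "('a::{field,finite} \<times> 'a) set"
  assumes large: "card S \<ge> CARD('a)"
  shows "\<exists>u. 2 * card (dilate_sum u ` S) > CARD('a)"
proof (rule ccontr)
  assume "\<not> ?thesis"
  then have small: "2 * card (dilate_sum u ` S) \<le> CARD('a)" for u by (simp add: not_less)
  have collisions: "2 * (card S)\<^sup>2 \<le> CARD('a) * card (collisions (dilate_sum u) S)" for u
  proof -
    have "2 * (card S)\<^sup>2 \<le> 2 * card (dilate_sum u ` S) * card (collisions (dilate_sum u) S)"
      using card_square_le_card_image_mult_collisions[of S "dilate_sum u"] by simp
    also have "\<dots> \<le> CARD('a) * card (collisions (dilate_sum u) S)"
      using small by (rule mult_right_mono) simp
    finally show ?thesis .
  qed
  have "CARD('a) * (2 * (card S)\<^sup>2) = (\<Sum>u\<in>(UNIV :: 'a set). 2 * (card S)\<^sup>2)" by simp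
  also have "\<dots> \<le> (\<Sum>u\<in>UNIV. CARD('a) * card (collisions (dilate_sum u) S))"
    by (intro sum_mono collisions)
  also have "\<dots> \<le> CARD('a) * ((card S)\<^sup>2 + card S * (CARD('a) - 1))"
    using sum_card_collisions_dilate_sum_le[of S] by (simp flip: sum_distrib_left)
  finally have "card S * card S \<le> card S * (CARD('a) - 1)" by (simp add: power2_eq_square)
  moreover have "CARD('a) > 0" by simp
  then have "card S > 0" using large by linarith
  ultimately have "card S \<le> CARD('a) - 1" by (simp only: nat_mult_le_cancel1)
  then show False using large \<open>CARD('a) > 0\<close> by linarith
qed

lemma sum_of_two_if_card_gt_half:
  fixes Z :: "'a::{ab_group_add,finite} set"
  assumes "2 * card Z > CARD('a)"
  shows "\<exists>s\<in>Z. \<exists>s'\<in>Z. t = s + s'"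
proof -
  have "card ((\<lambda>s. t - s) ` Z) = card Z" by (intro card_image inj_onI) auto
  then have "Z \<inter> (\<lambda>s. t - s) ` Z \<noteq> {}"
    using assms card_Un_disjoint[of Z "(\<lambda>s. t - s) ` Z"] card_mono[of UNIV "Z \<union> (\<lambda>s. t - s) ` Z"]
    by auto
  then show ?thesis by force
qed

section \<open>Long sums\<close>

definition sums_of :: "nat \<Rightarrow> 'a::comm_monoid_add set \<Rightarrow> 'a set" where
  "sums_of m P = {sum_list xs |xs. set xs \<subseteq> P \<and> length xs = m}"

lemma sums_of_0: "0 \<in> sums_of 0 P"
  by (simp add: sums_of_def)

lemma sums_of_singleton: "x \<in> P \<Longrightarrow> x \<in> sums_of 1 P"
  unfolding sums_of_def by (auto intro!: exI[of _ "[x]"])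

lemma sums_of_add:
  assumes "x \<in> sums_of a P" "y \<in> sums_of b P"
  shows "x + y \<in> sums_of (a + b) P"
proof -
  obtain xs ys where "x = sum_list xs" "set xs \<subseteq> P" "length xs = a"
    "y = sum_list ys" "set ys \<subseteq> P" "length ys = b"
    using assms by (auto simp: sums_of_def)
  then show ?thesis unfolding sums_of_def by (intro CollectI exI[of _ "xs @ ys"]) auto
qed

lemma sums_of_sum:
  assumes "finite I" "\<And>i. i \<in> I \<Longrightarrow> f i \<in> P"
  shows "(\<Sum>i\<in>I. f i) \<in> sums_of (card I) P"
  using assms by (induction I rule: finite_induct) (auto intro: sums_of_0 sums_of_add[OF sums_of_singleton, simplified])

lemma zero_sums_of_mult: "0 \<in> sums_of a P \<Longrightarrow> 0 \<in> sums_of (c * a) P"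
  by (induction c) (auto intro: sums_of_0 dest: sums_of_add)

lemma sums_of_insert_zero:
  assumes "x \<in> sums_of m (insert 0 P)"
  obtains j where "j \<le> m" "x \<in> sums_of j P"
proof -
  obtain xs where xs: "x = sum_list xs" "set xs \<subseteq> insert 0 P" "length xs = m"
    using assms by (auto simp: sums_of_def)
  let ?ys = "filter (\<lambda>y. y \<noteq> 0) xs"
  have "sum_list ?ys = x"
    using sum_list_map_filter[of xs "\<lambda>y. y \<noteq> 0" "\<lambda>y. y"] xs(1) by simp
  then have "x \<in> sums_of (length ?ys) P" using xs(2) by (auto simp: sums_of_def intro!: exI[of _ ?ys])
  then show ?thesis using that[of "length ?ys"] xs(3) by (metis length_filter_le)
qed

lemma sums_of_uminus:
  fixes x :: "'a::ab_group_add"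
  assumes P: "\<And>y. y \<in> P \<Longrightarrow> - y \<in> sums_of c P" and x: "x \<in> sums_of m P"
  shows "- x \<in> sums_of (m * c) P"
proof -
  have "- sum_list xs \<in> sums_of (length xs * c) P" if "set xs \<subseteq> P" for xs
    using that
  proof (induction xs)
    case Nil
    then show ?case by (simp add: sums_of_0)
  next
    case (Cons y xs)
    then show ?case using sums_of_add[OF P[of y] Cons.IH] by simp
  qed
  then show ?thesis using x by (auto simp: sums_of_def)
qed

lemma sums_of_doubleE:
  assumes "t \<in> sums_of (2 * n) P"
  obtains f g where "\<forall>i<n. f i \<in> P \<and> g i \<in> P" "t = (\<Sum>i<n. f i + g i)"
proof -
  obtain xs where xs: "t = sum_list xs" "set xs \<subseteq> P" "length xs = 2 * n"
    using assms by (auto simp: sums_of_def)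
  have "t = sum_list (take n xs) + sum_list (drop n xs)"
    using xs(1) by (simp flip: sum_list_append)
  also have "\<dots> = (\<Sum>i<n. xs ! i + xs ! (n + i))"
    using xs(3) by (simp add: sum_list_sum_nth atLeast0LessThan sum.distrib)
  finally have "t = (\<Sum>i<n. xs ! i + xs ! (n + i))" .
  moreover have "xs ! i \<in> P" if "i < 2 * n" for i using that xs(2,3) nth_mem[of i xs] by auto
  ultimately show ?thesis using that[of "\<lambda>i. xs ! i" "\<lambda>i. xs ! (n + i)"] by simp
qed

text \<open>
  As \<open>card D\<^sup>2 > q\<close>, every \<open>u\<close> is a quotient of differences of elements of \<open>D\<close>, so clearing
  denominators embeds a dilate of a large set \<open>D + u D\<close> into \<open>2D - 2D\<close>.
\<close>

lemma exists_large_set_of_differences: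
  fixes D :: "'a::{field,finite} set"
  assumes mult: "\<And>x y. x \<in> D \<Longrightarrow> y \<in> D \<Longrightarrow> x * y \<in> D" and large: "(card D)\<^sup>2 > CARD('a)"
  obtains Z where "2 * card Z > CARD('a)" "\<And>s. s \<in> Z \<Longrightarrow> \<exists>v\<in>sums_of 2 D. \<exists>w\<in>sums_of 2 D. s = v - w"
proof -
  have card_DD: "card (D \<times> D) > CARD('a)" using large by (simp add: card_cartesian_product power2_eq_square)
  then obtain u where u: "2 * card (dilate_sum u ` (D \<times> D)) > CARD('a)"
    using exists_large_dilate_sum_image[of "D \<times> D"] by auto
  have "\<not> inj_on (dilate_sum u) (D \<times> D)"
  proof
    assume "inj_on (dilate_sum u) (D \<times> D)"
    then have "card (D \<times> D) \<le> CARD('a)" by (intro card_inj_on_le) auto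
    then show False using card_DD by simp
  qed
  then obtain a b c d where abcd: "a \<in> D" "b \<in> D" "c \<in> D" "d \<in> D"
    and collision: "a + u * b = c + u * d" "(a, b) \<noteq> (c, d)"
    by (auto simp: inj_on_def dilate_sum_def)
  have bd: "b \<noteq> d" using collision by auto
  have u_eq: "u * (d - b) = a - c" using collision(1) by (simp add: algebra_simps)
  have two: "v + w \<in> sums_of 2 D" if "v \<in> D" "w \<in> D" for v w
    using sums_of_add[OF sums_of_singleton[OF that(1)] sums_of_singleton[OF that(2)]]
    by (simp add: numeral_2_eq_2)
  show ?thesis
  proof
    have "card ((*) (d - b) ` dilate_sum u ` (D \<times> D)) = card (dilate_sum u ` (D \<times> D))"
      using bd by (intro card_image inj_onI) auto
    then show "2 * card ((*) (d - b) ` dilate_sum u ` (D \<times> D)) > CARD('a)" using u by simp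
  next
    fix s assume "s \<in> (*) (d - b) ` dilate_sum u ` (D \<times> D)"
    then obtain x y where xy: "x \<in> D" "y \<in> D" "s = (d - b) * (x + u * y)" by (auto simp: dilate_sum_def)
    then have "s = (d - b) * x + (u * (d - b)) * y" by (simp add: algebra_simps)
    also have "\<dots> = (d * x + a * y) - (b * x + c * y)" unfolding u_eq by (simp add: algebra_simps)
    finally show "\<exists>v\<in>sums_of 2 D. \<exists>w\<in>sums_of 2 D. s = v - w" using two mult abcd xy by blast
  qed
qed

lemma difference_of_four_sums:
  fixes D :: "'a::{field,finite} set"
  assumes mult: "\<And>x y. x \<in> D \<Longrightarrow> y \<in> D \<Longrightarrow> x * y \<in> D" and large: "(card D)\<^sup>2 > CARD('a)"
  obtains x y where "x \<in> sums_of 4 D" "y \<in> sums_of 4 D" "t = x - y"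
proof -
  obtain Z where Z: "2 * card Z > CARD('a)"
    "\<And>s. s \<in> Z \<Longrightarrow> \<exists>v\<in>sums_of 2 D. \<exists>w\<in>sums_of 2 D. s = v - w"
    using exists_large_set_of_differences[OF mult large] by blast
  obtain s s' where s: "s \<in> Z" "s' \<in> Z" "t = s + s'"
    using sum_of_two_if_card_gt_half[OF Z(1)] by metis
  obtain v w v' w' where two: "v \<in> sums_of 2 D" "w \<in> sums_of 2 D" "v' \<in> sums_of 2 D" "w' \<in> sums_of 2 D"
    and eq: "s = v - w" "s' = v' - w'" using Z(2)[OF s(1)] Z(2)[OF s(2)] by blast
  show ?thesis
  proof
    show "v + v' \<in> sums_of 4 D" "w + w' \<in> sums_of 4 D"
      using sums_of_add[OF two(1,3)] sums_of_add[OF two(2,4)] by simp_all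
    show "t = (v + v') - (w + w')" using s(3) eq by simp
  qed
qed

lemma coprime_nonnegative_combination:
  fixes p r b :: nat
  assumes "coprime p r" "r \<ge> 1" and b: "b \<ge> (r - 1) * p"
  obtains x y where "b = x * p + y * r"
proof -
  obtain c where c: "[p * c = 1] (mod r)" using cong_solve_coprime_nat[OF assms(1)] by auto
  define x where "x = (c * b) mod r"
  have "[x * p = c * b * p] (mod r)" unfolding x_def by (intro cong_mult) (auto simp: cong_def)
  also have "[c * b * p = b] (mod r)" using cong_scalar_left[OF c, of b] by (simp add: mult_ac)
  finally have cong: "[x * p = b] (mod r)" .
  have "x \<le> r - 1" using assms(2) by (simp add: x_def less_Suc_eq_le[symmetric])
  then have le: "x * p \<le> b" using b by (meson le_trans mult_le_mono1)
  then have "r dvd b - x * p" using cong by (metis cong_altdef_nat cong_sym)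
  then obtain y where "b - x * p = r * y" by (rule dvdE)
  then have "b = x * p + y * r" using le by (simp add: mult.commute)
  then show ?thesis by (rule that)
qed

locale root_of_unity_in_monoid =
  fixes P :: "'a::field set" and z :: 'a and r :: nat
  assumes one_mem: "1 \<in> P" and mult_mem: "x \<in> P \<Longrightarrow> y \<in> P \<Longrightarrow> x * y \<in> P"
    and z_mem: "z \<in> P" and z_neq_1: "z \<noteq> 1" and power_z: "z ^ r = 1" and r_pos: "r \<ge> 1"
begin

lemma power_z_mem: "z ^ i \<in> P"
  by (induction i) (auto intro: one_mem mult_mem z_mem)

lemma sum_powers_z: "(\<Sum>i<r. z ^ i) = 0"
  using z_neq_1 power_z geometric_sum[of z r] by simp

lemma zero_sums_of_order: "0 \<in> sums_of r P"
  using sums_of_sum[of "{..<r}" "\<lambda>i. z ^ i" P] sum_powers_z power_z_mem by simp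

lemma zero_sums_of_char: "0 \<in> sums_of CHAR('a) P"
  using sums_of_sum[of "{..<CHAR('a)}" "\<lambda>_. 1" P] one_mem by simp

lemma uminus_sums_of:
  assumes x: "x \<in> P"
  shows "- x \<in> sums_of (r - 1) P"
proof -
  have "{..<r} = insert 0 {1..<r}" using r_pos by auto
  then have "1 + (\<Sum>i\<in>{1..<r}. z ^ i) = 0" using sum_powers_z by simp
  then have "- x = (\<Sum>i\<in>{1..<r}. z ^ i * x)"
    unfolding sum_distrib_right[symmetric] by (simp add: add_eq_0_iff)
  then show ?thesis
    using sums_of_sum[of "{1..<r}" "\<lambda>i. z ^ i * x" P] x power_z_mem mult_mem by simp
qed

lemma zero_sums_of_long:
  assumes coprime: "coprime CHAR('a) r" and b: "b \<ge> (r - 1) * CHAR('a)"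
  shows "0 \<in> sums_of b P"
proof -
  obtain x y where "b = x * CHAR('a) + y * r"
    using coprime_nonnegative_combination[OF coprime r_pos b] .
  then show ?thesis
    using sums_of_add[OF zero_sums_of_mult[OF zero_sums_of_char] zero_sums_of_mult[OF zero_sums_of_order]]
    by simp
qed

end

lemma mem_sums_of_long:
  fixes P :: "'a::{field,finite} set"
  assumes "root_of_unity_in_monoid P z r" and coprime: "coprime CHAR('a) r"
    and large: "(card (insert 0 P))\<^sup>2 > CARD('a)" and m: "m \<ge> 4 * r + (r - 1) * CHAR('a)"
  shows "t \<in> sums_of m P"
proof -
  interpret root_of_unity_in_monoid P z r by fact
  have "x * y \<in> insert 0 P" if "x \<in> insert 0 P" "y \<in> insert 0 P" for x y
    using that mult_mem by auto
  then obtain x y where "x \<in> sums_of 4 (insert 0 P)" "y \<in> sums_of 4 (insert 0 P)" and t: "t = x - y"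
    using difference_of_four_sums[OF _ large] by metis
  then obtain i j where i: "i \<le> 4" "x \<in> sums_of i P" and j: "j \<le> 4" "y \<in> sums_of j P"
    using sums_of_insert_zero by metis
  have "t \<in> sums_of (i + j * (r - 1)) P"
    using sums_of_add[OF i(2) sums_of_uminus[OF uminus_sums_of j(2)]] t by simp
  moreover have "j * (r - 1) \<le> 4 * (r - 1)" using j(1) by (rule mult_right_mono) simp
  then have short: "i + j * (r - 1) \<le> 4 * r" using i(1) r_pos by (simp add: algebra_simps)
  then have "0 \<in> sums_of (m - (i + j * (r - 1))) P"
    using m by (intro zero_sums_of_long coprime) linarith
  ultimately have "t + 0 \<in> sums_of (i + j * (r - 1) + (m - (i + j * (r - 1)))) P" by (rule sums_of_add)
  then show ?thesis using short m by simp
qed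

section \<open>Matrices over finite fields\<close>

lemma mem_sums_of_nonzero_powers:
  fixes t :: "'a::{field,finite}"
  assumes k: "k \<ge> 1" and d: "d = gcd k (CARD('a) - 1)" "d\<^sup>2 < CARD('a)"
    and r: "r \<ge> 2" "r dvd (CARD('a) - 1) div d" "coprime CHAR('a) r"
    and m: "m \<ge> 4 * r + (r - 1) * CHAR('a)"
  shows "t \<in> sums_of m (nonzero_powers UNIV k)"
proof -
  obtain z where z: "z \<in> nonzero_powers (UNIV :: 'a set) k" "z \<noteq> 1" "z ^ r = 1"
    using finite_field.exists_root_of_unity_nonzero_powers[OF k r(1), where 'a = 'a] r(2) d(1) by blast
  interpret powers: finite_subfield_subgroup UNIV "nonzero_powers (UNIV :: 'a set) k"
    by (rule finite_field.finite_subfield_subgroup_nonzero_powers)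
  have "root_of_unity_in_monoid (nonzero_powers UNIV k) z r"
    using z r(1) powers.one_mem_H powers.mult_mem_H by unfold_locales auto
  moreover have "(card (insert 0 (nonzero_powers (UNIV :: 'a set) k)))\<^sup>2 > CARD('a)"
    using finite_field.card_powers_square_gt[OF k, where 'a = 'a] d by simp
  ultimately show ?thesis using r(3) m by (intro mem_sums_of_long)
qed

lemma exists_prime_divisor_le_half_pred:
  fixes p :: nat
  assumes "prime p" "p \<ge> 5" "gcd e (p - 1) \<ge> 2"
  obtains r where "prime r" "r dvd e" "r < p" "2 * r \<le> p - 1"
proof -
  obtain r where r: "prime r" "r dvd gcd e (p - 1)"
    using prime_factor_nat[of "gcd e (p - 1)"] assms(3) by auto
  then have "r dvd p - 1" by (meson dvd_trans gcd_dvd2)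
  then obtain c where c: "p - 1 = r * c" by (rule dvdE)
  have "c \<noteq> 1"
  proof
    assume "c = 1"
    then have "odd (p - 1)" using c r(1) assms(2) prime_odd_nat[of r] by simp
    moreover have "odd p" using assms prime_odd_nat by auto
    ultimately show False by simp
  qed
  then have "c \<ge> 2" using c assms(2) by (cases c) auto
  then have "2 * r \<le> p - 1" unfolding c by (simp add: mult.commute)
  moreover have "r < p" using \<open>2 * r \<le> p - 1\<close> assms(2) by linarith
  ultimately show ?thesis using that r by (meson dvd_trans gcd_dvd1)
qed

lemma four_mult_add_pred_mult_le:
  fixes p r n :: nat
  assumes r: "r \<ge> 1" "2 * r \<le> p - 1" and n: "((real p)\<^sup>2 - 3 * real p + 9) / 2 < real n"
  shows "4 * r + (r - 1) * p \<le> 2 * n"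
proof -
  have "2 * real r \<le> real p - 1" using r by linarith
  then have "(2 * real r) * (real p + 4) \<le> (real p - 1) * (real p + 4)" by (rule mult_right_mono) simp
  moreover have "0 \<le> (real p - 7 / 2)\<^sup>2" by simp
  ultimately have "4 * real r + (real r - 1) * real p \<le> 2 * real n"
    using n by (simp add: power2_eq_square field_simps)
  then have "real (4 * r + (r - 1) * p) \<le> real (2 * n)" using r(1) by (simp add: of_nat_diff)
  then show ?thesis by (simp only: of_nat_le_iff)
qed

lemma nonscalar_is_sum_of_two_powers_finite_field:
  fixes M :: "'a::{field,finite} mat"
  assumes M: "M \<in> carrier_mat n n" and nonscalar: "\<And>c. M \<noteq> c \<cdot>\<^sub>m 1\<^sub>m n"
    and p: "prime p" "p \<ge> 5" "CHAR('a) = p"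
    and k: "k \<ge> 1" "\<not> p dvd k" and d: "d = gcd k (CARD('a) - 1)" "d\<^sup>2 < CARD('a)"
    and common: "gcd ((CARD('a) - 1) div d) (p - 1) \<ge> 2"
    and n: "((real p)\<^sup>2 - 3 * real p + 9) / 2 < real n"
  shows "is_sum_of_two_powers k M"
proof -
  have of_nat_k: "of_nat k \<noteq> (0 :: 'a)" using k(2) p(3) by (simp add: of_nat_eq_0_iff_char_dvd)
  obtain r where r: "prime r" "r dvd (CARD('a) - 1) div d" "r < p" "2 * r \<le> p - 1"
    using exists_prime_divisor_le_half_pred[OF p(1,2) common] .
  have "coprime p r" using p(1) r(1,3) by (simp add: primes_coprime)
  moreover have "4 * r + (r - 1) * p \<le> 2 * n"
    using four_mult_add_pred_mult_le[OF prime_ge_1_nat[OF r(1)] r(4) n] .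
  ultimately have trace_mem: "mat_trace M \<in> sums_of (2 * n) (nonzero_powers UNIV k)"
    using mem_sums_of_nonzero_powers[OF k(1) d prime_ge_2_nat[OF r(1)] r(2)] p(3) by simp
  obtain f g where fg: "\<forall>i<n. f i \<in> nonzero_powers UNIV k \<and> g i \<in> nonzero_powers UNIV k"
    and trace: "mat_trace M = (\<Sum>i<n. f i + g i)"
    using sums_of_doubleE[OF trace_mem] .
  have "\<exists>x. x \<noteq> 0 \<and> f i = x ^ k" "\<exists>y. y \<noteq> 0 \<and> g i = y ^ k" if "i < n" for i
    using fg that by (auto simp: nonzero_powers_def)
  then obtain a b where ab: "\<And>i. i < n \<Longrightarrow> a i \<noteq> 0 \<and> f i = a i ^ k"
      "\<And>i. i < n \<Longrightarrow> b i \<noteq> 0 \<and> g i = b i ^ k"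
    by metis
  have "mat_trace M = (\<Sum>i<n. a i ^ k + b i ^ k)" unfolding trace using ab by (intro sum.cong) auto
  then show ?thesis using nonscalar_is_sum_of_two_powers[OF M nonscalar of_nat_k, of a b] ab by simp
qed

lemma pred_power4_less_power_if_ln_ext_less:
  fixes k q n :: nat
  assumes k: "k \<ge> 1" and q: "q > 1"
    and less: "4 * ln_ext (real k - 1) / ereal (ln (real q)) < ereal (real n)"
  shows "(k - 1) ^ 4 < q ^ n"
proof (cases "k = 1")
  case True
  then show ?thesis using q by simp
next
  case False
  define m where "m = real (k - 1)"
  have m: "m > 0" "real k - 1 = m" using k False by (auto simp: m_def of_nat_diff)
  have "4 * ln m / ln (real q) < real n"
    using less m q by (simp add: ln_ext_def numeral_eq_ereal)
  then have "ln (m ^ 4) < ln (real q ^ n)"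
    using m q by (simp add: ln_realpow pos_divide_less_eq mult.commute)
  then have "m ^ 4 < real q ^ n" using m(1) q by simp
  then have "real ((k - 1) ^ 4) < real (q ^ n)" by (simp add: m_def)
  then show ?thesis by (simp only: of_nat_less_iff)
qed

theorem theorem1p16:
  fixes p l q n k d :: nat
  assumes "prime p" and "p \<ge> 5"
    and "q = p ^ l" and "CARD('a::{field,finite}) = q"
    and "n \<ge> 2" and "k \<ge> 1"
    and "d = gcd k (q - 1)"
    and "q > d\<^sup>2"
    and "\<not> p dvd k"
    and "gcd ((q - 1) div d) (p - 1) \<ge> 2"
    and "ereal (real n) >
      max (ereal (((real p)\<^sup>2 - 3 * real p + 9) / 2))
          (4 * ln_ext (real k - 1) / ereal (ln (real q)))"
  shows "\<forall>M \<in> carrier_mat n n. \<exists>A \<in> carrier_mat n n. \<exists>B \<in> carrier_mat n n.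
    (M :: 'a mat) = A ^\<^sub>m k + B ^\<^sub>m k"
proof
  fix M :: "'a mat"
  assume M: "M \<in> carrier_mat n n"
  have card: "CARD('a) = p ^ l" using assms(3,4) by simp
  have bounds: "((real p)\<^sup>2 - 3 * real p + 9) / 2 < real n"
    "4 * ln_ext (real k - 1) / ereal (ln (real q)) < ereal (real n)"
    using assms(11) by simp_all
  have "is_sum_of_two_powers k M"
  proof (cases "\<exists>c. M = c \<cdot>\<^sub>m 1\<^sub>m n")
    case True
    have "(k - 1) ^ 4 < CARD('a) ^ n"
      using pred_power4_less_power_if_ln_ext_less[OF assms(6) _ bounds(2)] assms(4)
        finite_field.card_gt_1[where 'a = 'a] by simp
    then show ?thesis
      using True scalar_mat_is_sum_of_two_powers[OF assms(1) card _ assms(6)] assms(5) by auto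
  next
    case False
    then have "M \<noteq> c \<cdot>\<^sub>m 1\<^sub>m n" for c by blast
    from nonscalar_is_sum_of_two_powers_finite_field[OF M this assms(1,2)
        CHAR_finite_field[OF assms(1) card] assms(6,9)]
    show ?thesis using assms(4,7,8,10) bounds(1) by simp
  qed
  then show "\<exists>A\<in>carrier_mat n n. \<exists>B\<in>carrier_mat n n. M = A ^\<^sub>m k + B ^\<^sub>m k"
    using M by (simp add: is_sum_of_two_powers_def)
qed

end
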